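(* Let $f:\mathbb{R}^2\to\mathbb{R}$ and $g_i:\mathbb{R}^2\to\mathbb{R}$, $i=1,\dots,m$, be convex functions. Let $B\in\mathbb{N}$ and let $x\in[-B,B]^2$ (a real point) be such that $g_i(x)\le 0$ for all $i=1,\dots,m$. Let $\hat f^*$ denote the optimal value of $$\min\{f(\hat x): \hat x\in[-B,B]^2\cap\mathbb{Z}^2,\ g_i(\hat x)\le 0 \text{ for } i=1,\dots,m\}.$$ If $f(x)\le\hat f^*$, then, in a number of evaluations of $f$ and $g_1,\dots,g_m$ that is polynomial in $\ln(B)$, one can either (a) find a point $\hat x\in[-B,B]^2\cap\mathbb{Z}^2$ with $f(\hat x)=\hat f^*$ and $g_i(\hat x)\le 0$ for all $i=1,\dots,m$, or (b) show that there is no such point.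
   Context: The functions are accessed through evaluations: an evaluation of a function at a point returns its value at that point. The optimal value $\hat f^*$ is understood to be $+\infty$ if the feasible set of the minimization problem is empty. The statement asserts the existence of an algorithm which, given $B$, $x$ and access to $f,g_1,\dots,g_m$ by evaluations, correctly ends in outcome (a) or (b) within the stated number of evaluations. *)

theory Defs
  imports "HOL-Analysis.Analysis" "HOL-Computational_Algebra.Polynomial"
begin

text \<open>
  A deterministic algorithm that accesses an objective function and constraint functions only
  through evaluations, as an adaptive, well-founded query tree: the continuation receives the
  value of the queried function at the queried point. Computations other than evaluations are not
  restricted and cost nothing, so the tree records exactly the evaluations performed.
\<close>

datatype 'r eval_alg =
    Return 'r
  | Eval_objective "real^2" "real \<Rightarrow> 'r eval_alg"
  | Eval_constraint nat "real^2" "real \<Rightarrow> 'r eval_alg"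

primrec run :: "'r eval_alg \<Rightarrow> (real^2 \<Rightarrow> real) \<Rightarrow> (nat \<Rightarrow> real^2 \<Rightarrow> real) \<Rightarrow> 'r" where
  "run (Return r) f g = r"
| "run (Eval_objective y k) f g = run (k (f y)) f g"
| "run (Eval_constraint i y k) f g = run (k (g i y)) f g"

primrec num_evals :: "'r eval_alg \<Rightarrow> (real^2 \<Rightarrow> real) \<Rightarrow> (nat \<Rightarrow> real^2 \<Rightarrow> real) \<Rightarrow> nat" where
  "num_evals (Return r) f g = 0"
| "num_evals (Eval_objective y k) f g = Suc (num_evals (k (f y)) f g)"
| "num_evals (Eval_constraint i y k) f g = Suc (num_evals (k (g i y)) f g)"

text \<open>
  Constraint families are functions on all of \<open>nat\<close>, of which only the members \<open>1, \<dots>, m\<close> are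
  meaningful; an algorithm for \<open>m\<close> constraints must not query any other member.
\<close>

primrec queries_within :: "nat \<Rightarrow> 'r eval_alg \<Rightarrow> bool" where
  "queries_within m (Return r) \<longleftrightarrow> True"
| "queries_within m (Eval_objective y k) \<longleftrightarrow> (\<forall>v. queries_within m (k v))"
| "queries_within m (Eval_constraint i y k) \<longleftrightarrow> i \<in> {1..m} \<and> (\<forall>v. queries_within m (k v))"

definition square :: "nat \<Rightarrow> (real^2) set" where
  "square B = {y. \<forall>j. - real B \<le> y $ j \<and> y $ j \<le> real B}"

definition int_points :: "(real^2) set" where
  "int_points = {y. \<forall>j. y $ j \<in> \<int>}"

definition satisfies :: "nat \<Rightarrow> (nat \<Rightarrow> real^2 \<Rightarrow> real) \<Rightarrow> real^2 \<Rightarrow> bool" where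
  "satisfies m g y \<longleftrightarrow> (\<forall>i\<in>{1..m}. g i y \<le> 0)"

text \<open>The infimum is taken in \<^typ>\<open>ereal\<close>, so it is \<open>\<infinity>\<close> when there is no feasible point.\<close>

definition int_opt ::
  "nat \<Rightarrow> nat \<Rightarrow> (real^2 \<Rightarrow> real) \<Rightarrow> (nat \<Rightarrow> real^2 \<Rightarrow> real) \<Rightarrow> ereal" where
  "int_opt m B f g = (INF y \<in> {y \<in> square B \<inter> int_points. satisfies m g y}. ereal (f y))"

definition is_int_minimizer ::
  "nat \<Rightarrow> nat \<Rightarrow> (real^2 \<Rightarrow> real) \<Rightarrow> (nat \<Rightarrow> real^2 \<Rightarrow> real) \<Rightarrow> real^2 \<Rightarrow> bool" where
  "is_int_minimizer m B f g y \<longleftrightarrow>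
     y \<in> square B \<inter> int_points \<and> ereal (f y) = int_opt m B f g \<and> satisfies m g y"

datatype outcome = Found "real^2" | No_such_point

definition correct_outcome ::
  "nat \<Rightarrow> nat \<Rightarrow> (real^2 \<Rightarrow> real) \<Rightarrow> (nat \<Rightarrow> real^2 \<Rightarrow> real) \<Rightarrow> outcome \<Rightarrow> bool" where
  "correct_outcome m B f g r \<longleftrightarrow>
     (case r of
        Found y \<Rightarrow> is_int_minimizer m B f g y
      | No_such_point \<Rightarrow> \<not> (\<exists>y. is_int_minimizer m B f g y))"

end

theory Submission
  imports Defs
begin

text \<open>
  \<^bold>\<open>Reduction to comparisons.\<close> Let the penalty of a point be the larger of \<open>0\<close> and the constraint
  values there, and order points lexicographically by penalty and then objective value. Pairs of
  reals with the lexicographic order form an ordered vector space in which (penalty, objective) is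
  a convex function. Hence the order has the cut property of \<open>convex_preference\<close>: if \<open>z\<close> is a convex
  combination of \<open>u\<close>, \<open>v\<close>, \<open>w\<close> in which \<open>w\<close> really occurs, and \<open>u\<close> and \<open>v\<close> are at least as good as
  \<open>z\<close>, then \<open>w\<close> is no better than \<open>z\<close>. The hypothesis on the optimal value says that the given point
  \<open>x\<close> is at least as good as every integer point of the square. Two points are compared with
  \<open>2 (m + 1)\<close> evaluations, so it suffices to find a best integer point of the square with
  \<open>O((ln B)\<^sup>2)\<close> comparisons and to look at its penalty (\<open>correct_outcome_best\<close>).

  \<^bold>\<open>One line.\<close> Along a lattice line the order is unimodal, so bisection finds a best lattice point \<open>p\<close>
  of the line with \<open>O(ln B)\<close> comparisons. Suppose that \<open>w\<close> lies beyond the line as seen from \<open>x\<close> and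
  that the segment from \<open>x\<close> to \<open>w\<close> meets the line at distance one lattice step or more from \<open>p\<close>.
  Then the neighbour of \<open>p\<close> on that side lies in the triangle \<open>p x w\<close>, and by the cut property \<open>w\<close> is
  no better than this neighbour. So beyond the line only a cone with apex \<open>x\<close>, two lattice steps wide
  at the line, can hold something better (\<open>improving_beyond_line\<close>).

  \<^bold>\<open>Few lines.\<close> Use lattice coordinates \<open>(s, t)\<close> in which the line is \<open>t = 0\<close>, the point \<open>p\<close> is the
  origin and \<open>x = (- \<xi>, - h)\<close>. A shear and a reflection make \<open>0 \<le> \<xi> \<le> h / 2\<close>. If \<open>h\<close> is bounded, or
  if \<open>\<xi> < 1\<close>, then boundedly many lines cover the lattice points of the cone at heights
  \<open>0 < t \<le> h\<close>; the next line then has at least twice the distance from \<open>x\<close>. If \<open>\<xi> \<ge> 1\<close>, the cone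
  leans to the right, and after the two lines \<open>s = 0\<close> and \<open>s = 1\<close> the search goes on beyond the line
  \<open>s = 1\<close>, whose distance from \<open>x\<close> is only \<open>\<xi> + 1 \<le> 2 h / 3\<close>. With \<open>T\<close> the largest distance that is
  still of interest, the ratio \<open>T / h\<close> halves in a step of the first kind and does not grow in one of
  the second kind, while \<open>h\<close> grows by at most a constant factor, or is bounded afterwards, in the
  first and shrinks by a constant factor in the second. So \<open>O(ln B)\<close> steps bring \<open>T\<close> below \<open>h\<close>, and
  then nothing is left (\<open>cone_search\<close>).
\<close>

section \<open>Solving a problem by comparisons\<close>

text \<open>
An unknown relation \<open>R\<close> is known to satisfy \<open>I\<close>; at most \<open>n\<close> adaptive comparisons suffice to produce
some \<open>r\<close> with \<open>P r R\<close>. A derivation of this predicate is a decision tree. Knowledge gained on the way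
is collected in \<open>I\<close>, so that algorithms can be composed like proofs, without ever being written down.
\<close>

inductive solvable ::
  "nat \<Rightarrow> (('p \<Rightarrow> 'p \<Rightarrow> bool) \<Rightarrow> bool) \<Rightarrow> ('r \<Rightarrow> ('p \<Rightarrow> 'p \<Rightarrow> bool) \<Rightarrow> bool) \<Rightarrow> bool" where
  answer: "(\<And>R. I R \<Longrightarrow> P r R) \<Longrightarrow> solvable n I P"
| compare: "solvable n (\<lambda>R. I R \<and> R y z) P \<Longrightarrow> solvable n (\<lambda>R. I R \<and> \<not> R y z) P \<Longrightarrow>
    solvable (Suc n) I P"

lemma solvable_mono:
  assumes "solvable n I P" "n \<le> k" "\<And>R. J R \<Longrightarrow> I R" "\<And>r R. J R \<Longrightarrow> P r R \<Longrightarrow> Q r R"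
  shows "solvable k J Q"
  using assms
proof (induction arbitrary: J k rule: solvable.induct)
  case (answer I P r n)
  then show ?case by (intro solvable.answer[of J Q r]) auto
next
  case (compare n I y z P)
  then obtain k' where k: "k = Suc k'" "n \<le> k'" by (cases k) auto
  have "solvable k' (\<lambda>R. J R \<and> R y z) Q"
    by (rule compare.IH(1)) (use compare.prems k in auto)
  moreover have "solvable k' (\<lambda>R. J R \<and> \<not> R y z) Q"
    by (rule compare.IH(2)) (use compare.prems k in auto)
  ultimately show ?case unfolding k by (rule solvable.compare)
qed

lemma solvable_bind:
  assumes "solvable n I P" "\<And>r. solvable k (\<lambda>R. I R \<and> P r R) Q"
  shows "solvable (n + k) I Q"
  using assms
proof (induction rule: solvable.induct)
  case (answer I P r n)
  show ?case
    by (rule solvable_mono[OF answer(2)[of r]]) (use answer(1) in auto)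
next
  case (compare n I y z P)
  have "solvable (n + k) (\<lambda>R. I R \<and> R y z) Q"
    by (rule compare.IH(1), rule solvable_mono[OF compare.prems]) auto
  moreover have "solvable (n + k) (\<lambda>R. I R \<and> \<not> R y z) Q"
    by (rule compare.IH(2), rule solvable_mono[OF compare.prems]) auto
  ultimately show ?case unfolding add_Suc by (rule solvable.compare)
qed

text \<open>
Moves a consequence of the knowledge that does not depend on the relation into the proof context.
\<close>

lemma solvable_assume:
  assumes "\<And>R. I R \<Longrightarrow> A" "A \<Longrightarrow> solvable n I P"
  shows "solvable n I P"
  using assms by (cases A) (auto intro: solvable.answer)

section \<open>Lattice coordinates\<close>

text \<open>
Affine coordinates of the plane in which the integer points are again the points with integer
coordinates, that is, the action of an affine unimodular map.
\<close>

definition lattice_chart :: "(real \<Rightarrow> real \<Rightarrow> real^2) \<Rightarrow> bool" where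
  "lattice_chart L \<longleftrightarrow>
     (\<exists>p d e. \<forall>s t. L s t = p + s *\<^sub>R d + t *\<^sub>R e) \<and>
     (\<forall>y. \<exists>s t. y = L s t) \<and>
     (\<forall>s t. L s t \<in> int_points \<longleftrightarrow> s \<in> \<int> \<and> t \<in> \<int>)"

lemma lattice_chart_combination:
  assumes "lattice_chart L" "a + b + c = 1"
  shows "a *\<^sub>R L s t + b *\<^sub>R L s' t' + c *\<^sub>R L s'' t'' =
    L (a * s + b * s' + c * s'') (a * t + b * t' + c * t'')"
proof -
  obtain p d e where L: "\<And>s t. L s t = p + s *\<^sub>R d + t *\<^sub>R e"
    using assms(1) unfolding lattice_chart_def by blast
  have "p = (a + b + c) *\<^sub>R p" using assms(2) by simp
  then show ?thesis unfolding L by (simp add: algebra_simps)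
qed

lemma lattice_chart_shift_shear:
  assumes L: "lattice_chart L" and "i \<in> \<int>" "j \<in> \<int>" "k \<in> \<int>"
  shows "lattice_chart (\<lambda>s t. L (s + i + k * t) (t + j))"
  unfolding lattice_chart_def
proof (intro conjI allI)
  obtain p d e where "\<And>s t. L s t = p + s *\<^sub>R d + t *\<^sub>R e"
    using L unfolding lattice_chart_def by blast
  then have "\<forall>s t. L (s + i + k * t) (t + j) = L i j + s *\<^sub>R d + t *\<^sub>R (e + k *\<^sub>R d)"
    by (simp add: algebra_simps)
  then show "\<exists>p d e. \<forall>s t. L (s + i + k * t) (t + j) = p + s *\<^sub>R d + t *\<^sub>R e" by blast
next
  fix y
  obtain s t where "y = L s t" using L unfolding lattice_chart_def by blast
  then have "y = L ((s - i - k * (t - j)) + i + k * (t - j)) ((t - j) + j)" by simp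
  then show "\<exists>s t. y = L (s + i + k * t) (t + j)" by blast
next
  fix s t
  have *: "L (s + i + k * t) (t + j) \<in> int_points \<longleftrightarrow> s + i + k * t \<in> \<int> \<and> t + j \<in> \<int>"
    using L unfolding lattice_chart_def by blast
  have t: "t + j \<in> \<int> \<longleftrightarrow> t \<in> \<int>" using assms(3) by (metis Ints_add Ints_diff add_diff_cancel_right')
  have s: "s + i + k * t \<in> \<int> \<longleftrightarrow> s \<in> \<int>" if "t \<in> \<int>"
  proof -
    have "i + k * t \<in> \<int>" using that assms by simp
    then show ?thesis by (metis Ints_add Ints_diff add_diff_cancel_right' add.assoc)
  qed
  show "L (s + i + k * t) (t + j) \<in> int_points \<longleftrightarrow> s \<in> \<int> \<and> t \<in> \<int>"
    unfolding * t using s by blast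
qed

lemma lattice_chart_shift:
  assumes "lattice_chart L" "i \<in> \<int>" "j \<in> \<int>"
  shows "lattice_chart (\<lambda>s t. L (s + i) (t + j))"
  using lattice_chart_shift_shear[OF assms Ints_0] by simp

lemma lattice_chart_flip:
  assumes L: "lattice_chart L"
  shows "lattice_chart (\<lambda>s t. L (- s) t)"
  unfolding lattice_chart_def
proof (intro conjI allI)
  obtain p d e where "\<And>s t. L s t = p + s *\<^sub>R d + t *\<^sub>R e"
    using L unfolding lattice_chart_def by blast
  then have "\<forall>s t. L (- s) t = p + s *\<^sub>R (- d) + t *\<^sub>R e" by simp
  then show "\<exists>p d e. \<forall>s t. L (- s) t = p + s *\<^sub>R d + t *\<^sub>R e" by blast
  fix y show "\<exists>s t. y = L (- s) t"
    using L unfolding lattice_chart_def by (metis minus_minus)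
next
  fix s t
  have "L (- s) t \<in> int_points \<longleftrightarrow> - s \<in> \<int> \<and> t \<in> \<int>" using L unfolding lattice_chart_def by blast
  then show "L (- s) t \<in> int_points \<longleftrightarrow> s \<in> \<int> \<and> t \<in> \<int>" by simp
qed

lemma lattice_chart_swap:
  assumes L: "lattice_chart L"
  shows "lattice_chart (\<lambda>s t. L t s)"
  unfolding lattice_chart_def
proof (intro conjI allI)
  obtain p d e where "\<And>s t. L s t = p + s *\<^sub>R d + t *\<^sub>R e"
    using L unfolding lattice_chart_def by blast
  then have "\<forall>s t. L t s = p + s *\<^sub>R e + t *\<^sub>R d" by simp
  then show "\<exists>p d e. \<forall>s t. L t s = p + s *\<^sub>R d + t *\<^sub>R e" by blast
  fix y show "\<exists>s t. y = L t s" using L unfolding lattice_chart_def by metis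
next
  fix s t show "L t s \<in> int_points \<longleftrightarrow> s \<in> \<int> \<and> t \<in> \<int>"
    using L unfolding lattice_chart_def by blast
qed

lemma lattice_chart_int_points:
  "lattice_chart L \<Longrightarrow> L s t \<in> int_points \<longleftrightarrow> s \<in> \<int> \<and> t \<in> \<int>"
  unfolding lattice_chart_def by blast

lemma lattice_chart_surj: "lattice_chart L \<Longrightarrow> \<exists>s t. y = L s t"
  unfolding lattice_chart_def by blast

text \<open>
The direction vector of a lattice line is a nonzero integer vector, so that consecutive lattice points
of the line differ by at least one in some coordinate.
\<close>

lemma lattice_line_in_square:
  assumes L: "lattice_chart L"
    and "L (of_int k) 0 \<in> square B" "L (of_int l) 0 \<in> square B"
  shows "\<bar>k - l\<bar> \<le> 2 * int B"
proof -
  obtain p d e where lin: "\<And>s t. L s t = p + s *\<^sub>R d + t *\<^sub>R e"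
    using L unfolding lattice_chart_def by blast
  have "d \<noteq> 0"
  proof
    assume "d = 0"
    then have "L (1/2) 0 = L 0 0" unfolding lin by simp
    then have "(1/2::real) \<in> \<int>"
      using lattice_chart_int_points[OF L, of "1/2" 0] lattice_chart_int_points[OF L, of 0 0] by simp
    then obtain n :: int where "1/2 = real_of_int n" by (metis Ints_cases)
    then have "real_of_int (2 * n) = of_int 1" by simp
    then have "2 * n = 1" by linarith
    then show False by presburger
  qed
  then obtain j where j: "d $ j \<noteq> 0" by (auto simp: vec_eq_iff)
  have "L 1 0 \<in> int_points" "L 0 0 \<in> int_points" using lattice_chart_int_points[OF L] by auto
  then have "L 1 0 $ j - L 0 0 $ j \<in> \<int>" unfolding int_points_def by auto
  then have "d $ j \<in> \<int>" unfolding lin by simp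
  then have "1 \<le> \<bar>d $ j\<bar>" using j Ints_nonzero_abs_ge1 by blast
  then have "\<bar>real_of_int (k - l)\<bar> \<le> \<bar>real_of_int (k - l)\<bar> * \<bar>d $ j\<bar>"
    by (simp add: mult_le_cancel_left1)
  also have "\<dots> = \<bar>L (of_int k) 0 $ j - L (of_int l) 0 $ j\<bar>"
    unfolding lin by (simp add: abs_mult[symmetric] algebra_simps)
  also have "\<dots> \<le> 2 * real B"
  proof -
    have "- real B \<le> L (of_int k) 0 $ j" "L (of_int k) 0 $ j \<le> real B"
      "- real B \<le> L (of_int l) 0 $ j" "L (of_int l) 0 $ j \<le> real B"
      using assms(2,3) unfolding square_def by blast+
    then show ?thesis by linarith
  qed
  finally have "real_of_int \<bar>k - l\<bar> \<le> of_int (2 * int B)" by simp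
  then show ?thesis by linarith
qed

section \<open>Convex preferences and bisection on a lattice line\<close>

text \<open>
\<open>R y z\<close> reads ``\<open>y\<close> is at least as good as \<open>z\<close>''. The last clause is stronger than convexity of the
sets \<open>{y. R y z}\<close>: it also excludes that moving on from a plateau leads to a better point, as for a
function that is convex and not only quasiconvex.
\<close>

definition convex_preference :: "('p::real_vector \<Rightarrow> 'p \<Rightarrow> bool) \<Rightarrow> bool" where
  "convex_preference R \<longleftrightarrow>
     (\<forall>y z. R y z \<or> R z y) \<and>
     (\<forall>y z w. R y z \<longrightarrow> R z w \<longrightarrow> R y w) \<and>
     (\<forall>u v w z a b c. 0 \<le> a \<longrightarrow> 0 \<le> b \<longrightarrow> 0 < c \<longrightarrow> a + b + c = 1 \<longrightarrow>
        z = a *\<^sub>R u + b *\<^sub>R v + c *\<^sub>R w \<longrightarrow> R u z \<longrightarrow> R v z \<longrightarrow> R z w)"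

lemma convex_preference_total: "convex_preference R \<Longrightarrow> R y z \<or> R z y"
  unfolding convex_preference_def by blast

lemma convex_preference_refl: "convex_preference R \<Longrightarrow> R y y"
  unfolding convex_preference_def by blast

lemma convex_preference_trans: "convex_preference R \<Longrightarrow> R y z \<Longrightarrow> R z w \<Longrightarrow> R y w"
  unfolding convex_preference_def by blast

lemma convex_preference_cut:
  "convex_preference R \<Longrightarrow> 0 \<le> a \<Longrightarrow> 0 \<le> b \<Longrightarrow> 0 < c \<Longrightarrow> a + b + c = 1 \<Longrightarrow>
     z = a *\<^sub>R u + b *\<^sub>R v + c *\<^sub>R w \<Longrightarrow> R u z \<Longrightarrow> R v z \<Longrightarrow> R z w"
  unfolding convex_preference_def by blast

text \<open>
All that the search uses about the functions. The points of the square that are not integral may well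
be better than \<open>x\<close>.
\<close>

definition instance_at :: "nat \<Rightarrow> real^2 \<Rightarrow> (real^2 \<Rightarrow> real^2 \<Rightarrow> bool) \<Rightarrow> bool" where
  "instance_at B x R \<longleftrightarrow> convex_preference R \<and> (\<forall>w \<in> square B \<inter> int_points. R x w)"

text \<open>
Unimodality: a step from \<open>k\<close> to \<open>l\<close> that does not improve is not followed by an improvement.
\<close>

lemma convex_preference_line:
  assumes R: "convex_preference R" and L: "lattice_chart L"
    and "R (L k t) (L l t)" and "k < l \<and> l \<le> n \<or> n \<le> l \<and> l < k"
  shows "R (L l t) (L n t)"
proof (cases "n = l")
  case True
  then show ?thesis using convex_preference_refl[OF R] by simp
next
  case False
  define c where "c = (l - k) / (n - k)"
  have c: "0 < c" "c \<le> 1" "k + c * (n - k) = l"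
    using assms(4) False unfolding c_def by (auto simp: divide_simps)
  have "(1 - c) * k + 0 * k + c * n = l" using c(3) by (simp add: algebra_simps)
  moreover have "(1 - c) * t + 0 * t + c * t = t" by (simp add: algebra_simps)
  ultimately have "(1 - c) *\<^sub>R L k t + 0 *\<^sub>R L k t + c *\<^sub>R L n t = L l t"
    using lattice_chart_combination[OF L, of "1 - c" 0 c k t k t n t] by simp
  then show ?thesis
    using convex_preference_cut[OF R, of "1 - c" 0 c "L l t" "L k t" "L k t" "L n t"] c assms(3)
    by simp
qed

lemma bisection:
  assumes L: "lattice_chart L" and "i \<le> j" "j - i < 2 ^ n"
  shows "solvable n convex_preference
    (\<lambda>p R. p \<in> {i..j} \<and> (\<forall>k\<in>{i..j}. R (L (of_int p) 0) (L (of_int k) 0)))"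
  using assms(2,3)
proof (induction n arbitrary: i j)
  case 0
  then have "i = j" by simp
  then show ?case by (intro solvable.answer[of _ _ i]) (auto simp: convex_preference_refl)
next
  case (Suc n)
  show ?case
  proof (cases "i = j")
    case True
    then show ?thesis by (intro solvable.answer[of _ _ i]) (auto simp: convex_preference_refl)
  next
    case False
    define m where "m = (i + j) div 2"
    have m: "i \<le> m" "m < j" "m - i < 2 ^ n" "j - (m + 1) < 2 ^ n"
      using False Suc.prems unfolding m_def by auto
    let ?q = "\<lambda>k::int. L (of_int k) 0"
    let ?P = "\<lambda>p R. p \<in> {i..j} \<and> (\<forall>k\<in>{i..j}. R (?q p) (?q k))"
    have "solvable n (\<lambda>R. convex_preference R \<and> R (?q m) (?q (m + 1))) ?P"
    proof (rule solvable_mono[OF Suc.IH[of i m]])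
      fix p R assume R: "convex_preference R \<and> R (?q m) (?q (m + 1))"
        and p: "p \<in> {i..m} \<and> (\<forall>k\<in>{i..m}. R (?q p) (?q k))"
      have "R (?q p) (?q k)" if k: "k \<in> {i..j}" for k
      proof (cases "k \<le> m")
        case True then show ?thesis using p k by auto
      next
        case False
        then have "R (?q (m + 1)) (?q k)"
          using convex_preference_line[OF _ L, of R "of_int m" 0 "of_int (m + 1)" "of_int k"] R by simp
        moreover have "R (?q p) (?q m)" using p m by auto
        ultimately show ?thesis using R convex_preference_trans by blast
      qed
      then show "?P p R" using p m by auto
    qed (use m in auto)
    moreover have "solvable n (\<lambda>R. convex_preference R \<and> \<not> R (?q m) (?q (m + 1))) ?P"
    proof (rule solvable_mono[OF Suc.IH[of "m + 1" j]])
      fix p R assume R: "convex_preference R \<and> \<not> R (?q m) (?q (m + 1))"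
        and p: "p \<in> {m + 1..j} \<and> (\<forall>k\<in>{m + 1..j}. R (?q p) (?q k))"
      have R': "R (?q (m + 1)) (?q m)" using R convex_preference_total by blast
      have "R (?q p) (?q k)" if k: "k \<in> {i..j}" for k
      proof (cases "m < k")
        case True then show ?thesis using p k by auto
      next
        case False
        then have "R (?q m) (?q k)"
          using convex_preference_line[OF _ L, of R "of_int (m + 1)" 0 "of_int m" "of_int k"] R R' by simp
        moreover have "R (?q p) (?q (m + 1))" using p m by (metis add1_zle_eq atLeastAtMost_iff order_refl)
        ultimately show ?thesis using R R' convex_preference_trans by blast
      qed
      then show "?P p R" using p m by auto
    qed (use m in auto)
    ultimately show ?thesis by (rule solvable.compare)
  qed
qed

lemma convex_combination_3:
  assumes "convex Q" "u \<in> Q" "v \<in> Q" "w \<in> Q" "0 \<le> a" "0 \<le> b" "0 < c" "a + b + c = 1"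
  shows "a *\<^sub>R u + b *\<^sub>R v + c *\<^sub>R w \<in> Q"
proof -
  have w: "b / (b + c) + c / (b + c) = 1" using assms(6,7) by (simp add: add_divide_distrib[symmetric])
  have "(b / (b + c)) *\<^sub>R v + (c / (b + c)) *\<^sub>R w \<in> Q"
    using assms(3-8) w by (intro convexD[OF assms(1)]) auto
  then have "a *\<^sub>R u + (b + c) *\<^sub>R ((b / (b + c)) *\<^sub>R v + (c / (b + c)) *\<^sub>R w) \<in> Q"
    using assms(5-8) by (intro convexD[OF assms(1,2)]) auto
  moreover have "(b + c) * (b / (b + c)) = b" "(b + c) * (c / (b + c)) = c" using assms by auto
  ultimately show ?thesis by (simp only: scaleR_add_right scaleR_scaleR add.assoc)
qed

section \<open>The cone beyond a searched line\<close>

text \<open>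
The region \<open>Q\<close> will be the part of the square on one side of the horizontal line through \<open>x\<close>. The
number \<open>i\<close> bounds the depth of a bisection of the lattice points in \<open>Q\<close> on a line.
\<close>

locale lattice_region =
  fixes B i :: nat and x :: "real^2" and Q :: "(real^2) set"
  assumes Q_convex: "convex Q" and Q_square: "Q \<subseteq> square B" and x_in: "x \<in> Q"
    and B_less: "2 * int B < 2 ^ i"
begin

text \<open>
The lattice points that the incumbent \<open>b\<close> does not settle yet.
\<close>

definition improving :: "real^2 \<Rightarrow> (real^2 \<Rightarrow> real^2 \<Rightarrow> bool) \<Rightarrow> (real^2) set" where
  "improving b R = {w \<in> Q \<inter> int_points. \<not> R b w}"

lemma improving_antimono:
  assumes "convex_preference R" "R b' b"
  shows "improving b' R \<subseteq> improving b R"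
  using assms convex_preference_trans unfolding improving_def by blast

text \<open>
What is known after the line \<open>t = 0\<close> has been searched: a new incumbent \<open>b'\<close> and a reference point \<open>p\<close>
on the line. If no lattice point of the line lies in \<open>Q\<close>, then \<open>Q\<close> meets the line between two
consecutive lattice points, and \<open>p\<close> is the left one of them; this restricts the region beyond the
line as much as a minimum does.
\<close>

definition line_minimum ::
  "(real \<Rightarrow> real \<Rightarrow> real^2) \<Rightarrow> real^2 \<Rightarrow> (real^2) \<times> real \<Rightarrow> (real^2 \<Rightarrow> real^2 \<Rightarrow> bool) \<Rightarrow> bool" where
  "line_minimum L b = (\<lambda>(b', p) R. b' \<in> square B \<inter> int_points \<and> R b' b \<and> p \<in> \<int> \<and>
     (\<forall>s. L s 0 \<notin> improving b' R) \<and>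
     (if \<exists>k\<in>\<int>. L k 0 \<in> Q
      then L p 0 \<in> Q \<and> (\<forall>k\<in>\<int>. L k 0 \<in> Q \<longrightarrow> R (L p 0) (L k 0))
      else \<forall>s. L s 0 \<in> Q \<longrightarrow> p < s \<and> s < p + 1))"

lemma chart_section_convex:
  assumes L: "lattice_chart L" and Q: "L a t \<in> Q" "L b t \<in> Q" and s: "a \<le> s" "s \<le> b"
  shows "L s t \<in> Q"
proof (cases "a = b")
  case True then show ?thesis using Q s by simp
next
  case False
  define c where "c = (s - a) / (b - a)"
  have c: "0 \<le> c" "c \<le> 1" "a + c * (b - a) = s"
    using s False unfolding c_def by (auto simp: divide_simps)
  have "(1 - c) * a + 0 * a + c * b = s" using c(3) by (simp add: algebra_simps)
  moreover have "(1 - c) * t + 0 * t + c * t = t" by (simp add: algebra_simps)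
  ultimately have "(1 - c) *\<^sub>R L a t + c *\<^sub>R L b t = L s t"
    using lattice_chart_combination[OF L, of "1 - c" 0 c a t a t b t] by simp
  then show ?thesis using convexD[OF Q_convex Q, of "1 - c" c] c by simp
qed

lemma line_search:
  assumes L: "lattice_chart L"
  shows "solvable (Suc i) (\<lambda>R. convex_preference R \<and> b \<in> square B \<inter> int_points) (line_minimum L b)"
proof (cases "\<exists>k\<in>\<int>. L k 0 \<in> Q")
  case False
  have "\<exists>p\<in>\<int>. \<forall>s. L s 0 \<in> Q \<longrightarrow> p < s \<and> s < p + 1"
  proof (cases "\<exists>s. L s 0 \<in> Q")
    case True
    then obtain s0 where s0: "L s0 0 \<in> Q" by blast
    let ?p = "of_int \<lfloor>s0\<rfloor> :: real"
    have "?p < s \<and> s < ?p + 1" if s: "L s 0 \<in> Q" for s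
    proof (rule ccontr)
      assume "\<not> ?thesis"
      then consider "s \<le> ?p" | "?p + 1 \<le> s" by linarith
      then show False
      proof cases
        case 1
        then have "L ?p 0 \<in> Q" using chart_section_convex[OF L s s0] by simp
        then show False using False by auto
      next
        case 2
        have "s0 \<le> ?p + 1" by linarith
          then have "L (?p + 1) 0 \<in> Q" using 2 chart_section_convex[OF L s0 s] by blast
        moreover have "?p + 1 \<in> \<int>" by simp
        ultimately show False using False by blast
      qed
    qed
    then show ?thesis by (intro bexI[of _ ?p]) auto
  qed (auto intro: Ints_0)
  then obtain p where p: "p \<in> \<int>" "\<forall>s. L s 0 \<in> Q \<longrightarrow> p < s \<and> s < p + 1" by blast
  have "line_minimum L b (b, p) R" if "convex_preference R" "b \<in> square B \<inter> int_points" for R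
    using that p False lattice_chart_int_points[OF L] convex_preference_refl
    unfolding line_minimum_def improving_def by auto
  then show ?thesis by (intro solvable.answer[of _ _ "(b, p)"]) auto
next
  case True
  define A where "A = {k::int. L (of_int k) 0 \<in> Q}"
  have A_ne: "A \<noteq> {}" using True unfolding A_def by (auto elim!: Ints_cases)
  have width: "\<bar>k - l\<bar> \<le> 2 * int B" if "k \<in> A" "l \<in> A" for k l
    using lattice_line_in_square[OF L] that Q_square unfolding A_def by blast
  obtain k0 where k0: "k0 \<in> A" using A_ne by blast
  have "A \<subseteq> {k0 - 2 * int B..k0 + 2 * int B}" using width[OF _ k0] by force
  then have fin: "finite A" by (rule finite_subset) simp
  define lo hi where "lo = Min A" and "hi = Max A"
  have mem: "lo \<in> A" "hi \<in> A" unfolding lo_def hi_def using fin A_ne by auto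
  have A: "A = {lo..hi}"
  proof
    show "A \<subseteq> {lo..hi}" unfolding lo_def hi_def using fin by auto
    show "{lo..hi} \<subseteq> A"
    proof
      fix k assume "k \<in> {lo..hi}"
      then show "k \<in> A"
        using chart_section_convex[OF L, of "of_int lo" 0 "of_int hi" "of_int k"] mem
        unfolding A_def by auto
    qed
  qed
  have "lo \<le> hi" using mem A by auto
  moreover have "hi - lo < 2 ^ i" using width[OF mem(2,1)] B_less by linarith
  ultimately have search: "solvable i convex_preference
      (\<lambda>p R. p \<in> {lo..hi} \<and> (\<forall>k\<in>{lo..hi}. R (L (of_int p) 0) (L (of_int k) 0)))"
    by (rule bisection[OF L])
  let ?I = "\<lambda>p R. (convex_preference R \<and> b \<in> square B \<inter> int_points) \<and>
      p \<in> A \<and> (\<forall>k\<in>A. R (L (of_int p) 0) (L (of_int k) 0))"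
  have fin: "line_minimum L b (b', of_int p) R"
    if I: "?I p R" and b': "b' \<in> square B \<inter> int_points" "R b' b" "R b' (L (of_int p) 0)" for p R b'
  proof -
    have all: "R (L (of_int p) 0) (L k 0)" if k: "k \<in> \<int>" "L k 0 \<in> Q" for k
      using k I unfolding A_def by (auto elim!: Ints_cases)
    have "R b' (L s 0)" if "L s 0 \<in> Q \<inter> int_points" for s
      using that all[of s] lattice_chart_int_points[OF L] I b'(3) convex_preference_trans by blast
    then show ?thesis
      using all I b' True unfolding line_minimum_def improving_def A_def by auto
  qed
  have "solvable (Suc 0) (?I p) (line_minimum L b)" for p
  proof (rule solvable.compare[where y = b and z = "L (of_int p) 0"])
    show "solvable 0 (\<lambda>R. ?I p R \<and> R b (L (of_int p) 0)) (line_minimum L b)"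
      by (rule solvable.answer, rule fin[where b' = b]) (auto intro: convex_preference_refl)
    show "solvable 0 (\<lambda>R. ?I p R \<and> \<not> R b (L (of_int p) 0)) (line_minimum L b)"
    proof (rule solvable.answer, rule fin)
      fix R assume R: "?I p R \<and> \<not> R b (L (of_int p) 0)"
      then show "?I p R" by blast
      show "R (L (of_int p) 0) b" using R convex_preference_total by blast
      show "R (L (of_int p) 0) (L (of_int p) 0)" using R convex_preference_refl by blast
      show "L (of_int p) 0 \<in> square B \<inter> int_points"
        using R Q_square lattice_chart_int_points[OF L] unfolding A_def by auto
    qed
  qed
  then have "solvable (i + Suc 0) (\<lambda>R. convex_preference R \<and> b \<in> square B \<inter> int_points)
      (line_minimum L b)"
  proof (rule solvable_bind[rotated])
    show "solvable i (\<lambda>R. convex_preference R \<and> b \<in> square B \<inter> int_points)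
        (\<lambda>p R. p \<in> A \<and> (\<forall>k\<in>A. R (L (of_int p) 0) (L (of_int k) 0)))"
      by (rule solvable_mono[OF search]) (auto simp: A)
  qed
  then show ?thesis by simp
qed

text \<open>
The segment from \<open>x\<close> to \<open>L s t\<close> meets the line \<open>t = 0\<close> at \<open>s = (h * s - \<xi> * t) / (t + h)\<close>, and the
conclusion says that this point is less than one lattice step away from \<open>p\<close>. Otherwise the neighbour
of \<open>p\<close> towards it would be a lattice point of \<open>Q\<close> in the triangle of \<open>p\<close>, \<open>x\<close> and \<open>L s t\<close>, at least as
bad as \<open>p\<close> and \<open>x\<close>, and the cut property would make \<open>L s t\<close> at least as bad as this neighbour.
\<close>

lemma improving_beyond_line:
  assumes L: "lattice_chart L" and x: "x = L (- \<xi>) (- h)" and "0 < h"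
    and R: "instance_at B x R" and min: "line_minimum L b (b', p) R"
    and w: "L s t \<in> improving b' R" and t: "0 \<le> t"
  shows "\<bar>h * s - \<xi> * t - p * (t + h)\<bar> < t + h"
proof -
  have wQ: "L s t \<in> Q" "\<not> R b' (L s t)" using w unfolding improving_def by auto
  have pref: "convex_preference R" using R unfolding instance_at_def by blast
  define D where "D = h * s - \<xi> * t - p * (t + h)"
  show ?thesis
  proof (cases "\<exists>k\<in>\<int>. L k 0 \<in> Q")
    case False
    have "(t / (t + h)) *\<^sub>R x + (h / (t + h)) *\<^sub>R L s t \<in> Q"
      using convexD[OF Q_convex x_in wQ(1)] t \<open>0 < h\<close> by (simp add: add_divide_distrib[symmetric])
    moreover have "(t / (t + h)) *\<^sub>R x + (h / (t + h)) *\<^sub>R L s t = L ((h * s - \<xi> * t) / (t + h)) 0"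
    proof -
      have "t / (t + h) + 0 + h / (t + h) = 1"
        using t \<open>0 < h\<close> by (simp add: add_divide_distrib[symmetric])
      then have "(t / (t + h)) *\<^sub>R L (- \<xi>) (- h) + 0 *\<^sub>R L 0 0 + (h / (t + h)) *\<^sub>R L s t =
        L (t / (t + h) * (- \<xi>) + 0 * 0 + h / (t + h) * s) (t / (t + h) * (- h) + 0 * 0 + h / (t + h) * t)"
        by (rule lattice_chart_combination[OF L])
      moreover have "t / (t + h) * (- \<xi>) + 0 * 0 + h / (t + h) * s = (h * s - \<xi> * t) / (t + h)"
        by (simp add: diff_divide_distrib)
      ultimately show ?thesis unfolding x by simp
    qed
    ultimately have "L ((h * s - \<xi> * t) / (t + h)) 0 \<in> Q" by simp
    then have "p < (h * s - \<xi> * t) / (t + h)" "(h * s - \<xi> * t) / (t + h) < p + 1"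
      using min False unfolding line_minimum_def by auto
    then show ?thesis using t \<open>0 < h\<close> by (auto simp: divide_simps algebra_simps abs_less_iff)
  next
    case True
    then have p: "L p 0 \<in> Q" "\<forall>k\<in>\<int>. L k 0 \<in> Q \<longrightarrow> R (L p 0) (L k 0)" "p \<in> \<int>"
      and b': "\<forall>s. L s 0 \<notin> improving b' R"
      using min unfolding line_minimum_def by auto
    have False if eps: "\<epsilon> \<in> {1, -1}" "t + h \<le> \<epsilon> * D" for \<epsilon> :: real
    proof -
      define E where "E = \<epsilon> * D"
      have E: "t + h \<le> E" "0 < E" "D = \<epsilon> * E" using eps t \<open>0 < h\<close> unfolding E_def by auto
      \<comment> \<open>Barycentric coordinates of the neighbour \<open>p + \<epsilon>\<close> in the triangle of \<open>p\<close>, \<open>x\<close> and \<open>L s t\<close>.\<close>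
      define c b a where "c = h / E" and "b = t / E" and "a = 1 - (t + h) / E"
      have abc: "0 \<le> a" "0 \<le> b" "0 < c" "a + b + c = 1"
        using E t \<open>0 < h\<close> unfolding a_def b_def c_def by (auto simp: divide_simps)
      let ?z = "L (p + \<epsilon>) 0"
      have "a * p + b * (- \<xi>) + c * s = p + D / E"
        unfolding a_def b_def c_def D_def using E(2) by (simp add: field_simps)
      then have "a * p + b * (- \<xi>) + c * s = p + \<epsilon>" using E by simp
      moreover have "a * 0 + b * (- h) + c * t = 0" unfolding b_def c_def by simp
      ultimately have z: "?z = a *\<^sub>R L p 0 + b *\<^sub>R x + c *\<^sub>R L s t"
        using lattice_chart_combination[OF L abc(4), of p 0 "- \<xi>" "- h" s t] unfolding x by simp
      have zQ: "?z \<in> Q"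
      proof -
        have "a *\<^sub>R L p 0 + b *\<^sub>R x + c *\<^sub>R L s t \<in> Q"
          by (rule convex_combination_3[OF Q_convex p(1) x_in wQ(1) abc])
        then show ?thesis unfolding z .
      qed
      have int: "p + \<epsilon> \<in> \<int>" using p(3) eps(1) by auto
      then have zi: "?z \<in> int_points" using lattice_chart_int_points[OF L] by simp
      have "R x ?z" using R zQ zi Q_square unfolding instance_at_def by blast
      moreover have "R (L p 0) ?z" using p(2) int zQ by blast
      ultimately have "R ?z (L s t)" using convex_preference_cut[OF pref abc z] by blast
      moreover have "R b' ?z" using b' zQ zi unfolding improving_def by blast
      ultimately show False using wQ(2) convex_preference_trans[OF pref] by blast
    qed
    from this[of 1] this[of "-1"] have "\<not> t + h \<le> D" "\<not> t + h \<le> - D" by auto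
    then show ?thesis unfolding D_def[symmetric] by linarith
  qed
qed

text \<open>
In the coordinates \<open>L\<close> the point \<open>x\<close> is \<open>(- \<xi>, - h)\<close>. Everything not yet settled lies beyond the line
\<open>t = 0\<close>, at distance at most \<open>T\<close> from \<open>x\<close> in the direction of \<open>t\<close>, and in the open cone from \<open>x\<close>
through the segment from \<open>(- 1, 0)\<close> to \<open>(1, 0)\<close>.
\<close>

definition cone_state ::
  "(real \<Rightarrow> real \<Rightarrow> real^2) \<Rightarrow> real \<Rightarrow> real \<Rightarrow> real \<Rightarrow> real^2 \<Rightarrow> (real^2 \<Rightarrow> real^2 \<Rightarrow> bool) \<Rightarrow> bool" where
  "cone_state L \<xi> h T b R \<longleftrightarrow> instance_at B x R \<and> b \<in> square B \<inter> int_points \<and>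
     (\<forall>s t. L s t \<in> improving b R \<longrightarrow> 0 < t \<and> t + h \<le> T \<and> \<bar>h * s - \<xi> * t\<bar> < t + h)"

lemma cone_state_short:
  assumes "cone_state L \<xi> h T b R" "lattice_chart L" "T \<le> h"
  shows "improving b R = {}"
proof (rule equals0I)
  fix w assume "w \<in> improving b R"
  moreover obtain s t where "w = L s t" using lattice_chart_surj[OF assms(2)] by blast
  ultimately have "0 < t" "t + h \<le> T" using assms(1) unfolding cone_state_def by blast+
  then show False using assms(3) by simp
qed

lemma sweep:
  assumes L: "lattice_chart L"
  shows "solvable (n * Suc i) (\<lambda>R. instance_at B x R \<and> b \<in> square B \<inter> int_points)
    (\<lambda>b' R. b' \<in> square B \<inter> int_points \<and> R b' b \<and>
       (\<forall>s. \<forall>j<n. L s (real j) \<notin> improving b' R))"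
proof (induction n)
  case 0
  show ?case by (rule solvable.answer[of _ _ b]) (auto simp: instance_at_def convex_preference_refl)
next
  case (Suc n)
  let ?I = "\<lambda>R. instance_at B x R \<and> b \<in> square B \<inter> int_points"
  let ?P = "\<lambda>n b' R. b' \<in> square B \<inter> int_points \<and> R b' b \<and>
       (\<forall>s. \<forall>j<n. L s (real j) \<notin> improving b' R)"
  let ?L = "\<lambda>s t. L (s + 0) (t + real n)"
  have "solvable (Suc i) (\<lambda>R. ?I R \<and> ?P n b1 R) (?P (Suc n))" for b1
  proof -
    have chart: "lattice_chart ?L" by (rule lattice_chart_shift[OF L]) auto
    have "solvable (Suc i) (\<lambda>R. ?I R \<and> ?P n b1 R) (\<lambda>(r :: (real^2) \<times> real) R. ?P (Suc n) (fst r) R)"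
    proof (rule solvable_mono[OF line_search[OF chart, of b1]])
      fix r :: "(real^2) \<times> real" and R assume I: "?I R \<and> ?P n b1 R" and min: "line_minimum ?L b1 r R"
      obtain b' p where r: "r = (b', p)" by (cases r)
      have m: "b' \<in> square B \<inter> int_points" "R b' b1" "\<forall>s. ?L s 0 \<notin> improving b' R"
        using min unfolding r line_minimum_def by auto
      have pref: "convex_preference R" using I unfolding instance_at_def by blast
      have sub: "improving b' R \<subseteq> improving b1 R" by (rule improving_antimono[OF pref m(2)])
      have "R b' b" using I m(2) convex_preference_trans[OF pref] by blast
      moreover have "L s (real j) \<notin> improving b' R" if "j < Suc n" for s j
        using that I sub m(3) by (cases "j = n") auto
      ultimately show "?P (Suc n) (fst r) R" using m(1) unfolding r by auto
    qed (auto simp: instance_at_def)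
    then have "solvable (Suc i + 0) (\<lambda>R. ?I R \<and> ?P n b1 R) (?P (Suc n))"
    proof (rule solvable_bind)
      show "solvable 0 (\<lambda>R. (?I R \<and> ?P n b1 R) \<and> ?P (Suc n) (fst r) R) (?P (Suc n))" for r :: "(real^2) \<times> real"
        by (rule solvable.answer[where r = "fst r"]) blast
    qed
    then show ?thesis by simp
  qed
  then have "solvable (n * Suc i + Suc i) ?I (?P (Suc n))" by (rule solvable_bind[OF Suc.IH])
  then show ?case unfolding mult_Suc add.commute[of "Suc i"] .
qed

text \<open>
Searching the line \<open>t = 0\<close> replaces the knowledge that the rest lies on or beyond this line by the cone
around the reference point, which becomes the origin of the new coordinates.
\<close>

lemma line_step:
  assumes L: "lattice_chart L" and x: "x = L (- \<xi>) (- h)" and h: "0 < h"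
  shows "solvable (Suc i)
    (\<lambda>R. instance_at B x R \<and> b \<in> square B \<inter> int_points \<and>
       (\<forall>s t. L s t \<in> improving b R \<longrightarrow> 0 \<le> t \<and> t + h \<le> T))
    (\<lambda>r R. snd r \<in> \<int> \<and> cone_state (\<lambda>s t. L (s + snd r) (t + 0)) (\<xi> + snd r) h T (fst r) R)"
proof (rule solvable_mono[OF line_search[OF L, of b]])
  fix r R
  assume I: "instance_at B x R \<and> b \<in> square B \<inter> int_points \<and>
       (\<forall>s t. L s t \<in> improving b R \<longrightarrow> 0 \<le> t \<and> t + h \<le> T)"
    and min: "line_minimum L b r R"
  obtain b' p where r: "r = (b', p)" by (cases r)
  have m: "b' \<in> square B \<inter> int_points" "R b' b" "p \<in> \<int>" "\<forall>s. L s 0 \<notin> improving b' R"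
    using min unfolding r line_minimum_def by auto
  have sub: "improving b' R \<subseteq> improving b R"
    using I m(2) improving_antimono unfolding instance_at_def by blast
  have "0 < t \<and> t + h \<le> T \<and> \<bar>h * s - (\<xi> + p) * t\<bar> < t + h"
    if w: "L (s + p) (t + 0) \<in> improving b' R" for s t
  proof -
    have t: "0 \<le> t" "t + h \<le> T" using w sub I by auto
    moreover have "t \<noteq> 0" using w m(4) by auto
    moreover have "\<bar>h * (s + p) - \<xi> * t - p * (t + h)\<bar> < t + h"
      using improving_beyond_line[OF L x h _ min[unfolded r], of "s + p" t] w t I by simp
    moreover have "h * (s + p) - \<xi> * t - p * (t + h) = h * s - (\<xi> + p) * t"
      by (simp add: algebra_simps)
    ultimately show ?thesis by simp
  qed
  then show "snd r \<in> \<int> \<and> cone_state (\<lambda>s t. L (s + snd r) (t + 0)) (\<xi> + snd r) h T (fst r) R"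
    using I m unfolding cone_state_def r by auto
qed (auto simp: instance_at_def)

section \<open>Searching the cone\<close>

text \<open>
The common form of all steps of the search: sweep the lines \<open>t = 0, \<dots>, n - 1\<close> of one chart, after
which the line \<open>t = 0\<close> of a second chart has all the rest on it or beyond it, then search that line
and continue in the cone obtained. The bound \<open>n \<le> 5\<close> only serves to give every step the same cost.
\<close>

lemma sweep_then_line:
  fixes I :: "(real^2 \<Rightarrow> real^2 \<Rightarrow> bool) \<Rightarrow> bool"
  assumes L1: "lattice_chart L1" and L2: "lattice_chart L2" and x: "x = L2 (- \<xi>) (- h)" and h: "0 < h"
    and n: "n \<le> 5"
    and I: "\<And>R. I R \<Longrightarrow> instance_at B x R \<and> b \<in> square B \<inter> int_points"
    and swept: "\<And>R s t. I R \<Longrightarrow> L2 s t \<in> improving b R \<Longrightarrow>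
      (\<And>s' j. j < n \<Longrightarrow> L2 s t \<noteq> L1 s' (real j)) \<Longrightarrow> 0 \<le> t \<and> t + h \<le> T"
    and continue: "\<And>b' p. p \<in> \<int> \<Longrightarrow>
      solvable k (cone_state (\<lambda>s t. L2 (s + p) (t + 0)) (\<xi> + p) h T b') G"
  shows "solvable (6 * Suc i + k) I G"
proof -
  let ?J = "\<lambda>b' R. I R \<and> b' \<in> square B \<inter> int_points \<and> R b' b \<and>
       (\<forall>s. \<forall>j<n. L1 s (real j) \<notin> improving b' R)"
  let ?K = "\<lambda>r R. snd r \<in> \<int> \<and>
       cone_state (\<lambda>s t. L2 (s + snd r) (t + 0)) (\<xi> + snd r) h T (fst r) R"
  have first: "solvable (n * Suc i) I (\<lambda>b' R. b' \<in> square B \<inter> int_points \<and> R b' b \<and>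
       (\<forall>s. \<forall>j<n. L1 s (real j) \<notin> improving b' R))"
    by (rule solvable_mono[OF sweep[OF L1]]) (use I in auto)
  have second: "solvable (Suc i) (?J b') ?K" for b'
  proof (rule solvable_mono[OF line_step[OF L2 x h, of b' T]])
    fix R assume J: "?J b' R"
    then have inst: "instance_at B x R" using I by blast
    then have sub: "improving b' R \<subseteq> improving b R"
      using J improving_antimono unfolding instance_at_def by blast
    have "0 \<le> t \<and> t + h \<le> T" if w: "L2 s t \<in> improving b' R" for s t
    proof (rule swept)
      show "L2 s t \<noteq> L1 s' (real j)" if "j < n" for s' j using J w that by auto
    qed (use J w sub in auto)
    then show "instance_at B x R \<and> b' \<in> square B \<inter> int_points \<and>
       (\<forall>s t. L2 s t \<in> improving b' R \<longrightarrow> 0 \<le> t \<and> t + h \<le> T)"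
      using inst J by blast
  qed auto
  have third: "solvable k (\<lambda>R. ?J b' R \<and> ?K r R) G" for b' r
  proof (rule solvable_assume)
    assume "snd r \<in> \<int>"
    from continue[OF this, of "fst r"] show "solvable k (\<lambda>R. ?J b' R \<and> ?K r R) G"
      by (rule solvable_mono) auto
  qed auto
  have "solvable (Suc i + k) (?J b') G" for b'
    by (rule solvable_bind[OF second third])
  then have "solvable (n * Suc i + (Suc i + k)) I G"
    by (rule solvable_bind[OF first])
  moreover have "n * Suc i + (Suc i + k) \<le> 6 * Suc i + k"
  proof -
    have "n * q + (q + k) \<le> 6 * q + k" for q using mult_le_mono1[OF n, of q] by linarith
    then show ?thesis .
  qed
  ultimately show ?thesis by (rule solvable_mono) auto
qed

text \<open>
Shears along the line \<open>t = 0\<close> fix that line pointwise, hence preserve the cone, and change \<open>\<xi>\<close> by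
integer multiples of \<open>h\<close>.
\<close>

lemma cone_state_normalize:
  assumes L: "lattice_chart L" and x: "x = L (- \<xi>) (- h)" and h: "0 < h"
  obtains L' \<xi>' where "lattice_chart L'" "x = L' (- \<xi>') (- h)" "0 \<le> \<xi>'" "\<xi>' \<le> h / 2"
    "\<And>T b R. cone_state L \<xi> h T b R \<Longrightarrow> cone_state L' \<xi>' h T b R"
proof -
  define k where "k = real_of_int (round (\<xi> / h))"
  define L1 where "L1 = (\<lambda>s t. L (s + 0 + k * t) (t + 0))"
  define \<xi>1 where "\<xi>1 = \<xi> - k * h"
  have "\<bar>k - \<xi> / h\<bar> \<le> 1 / 2" unfolding k_def by (rule of_int_round_abs_le)
  then have "\<bar>k - \<xi> / h\<bar> * h \<le> 1 / 2 * h" using h by (intro mult_right_mono) auto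
  moreover have "\<bar>k - \<xi> / h\<bar> * h = \<bar>(k - \<xi> / h) * h\<bar>" using h by (simp add: abs_mult)
  moreover have "(k - \<xi> / h) * h = - \<xi>1" using h unfolding \<xi>1_def by (simp add: field_simps)
  ultimately have bound: "\<bar>\<xi>1\<bar> \<le> h / 2" by simp
  have chart: "lattice_chart L1"
    unfolding L1_def by (rule lattice_chart_shift_shear[OF L]) (auto simp: k_def)
  have x1: "x = L1 (- \<xi>1) (- h)" unfolding x L1_def \<xi>1_def by simp
  have state: "cone_state L1 \<xi>1 h T b R" if st: "cone_state L \<xi> h T b R" for T b R
    unfolding cone_state_def
  proof (intro conjI allI impI)
    fix s t assume "L1 s t \<in> improving b R"
    then have "L (s + k * t) t \<in> improving b R" unfolding L1_def by simp
    then have "0 < t \<and> t + h \<le> T \<and> \<bar>h * (s + k * t) - \<xi> * t\<bar> < t + h"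
      using st unfolding cone_state_def by blast
    moreover have "h * (s + k * t) - \<xi> * t = h * s - \<xi>1 * t"
      unfolding \<xi>1_def by (simp add: algebra_simps)
    ultimately show "0 < t" "t + h \<le> T" "\<bar>h * s - \<xi>1 * t\<bar> < t + h" by auto
  qed (use st in \<open>auto simp: cone_state_def\<close>)
  show ?thesis
  proof (cases "0 \<le> \<xi>1")
    case True
    then show ?thesis using that[OF chart x1 _ _ state] bound by auto
  next
    case False
    have "x = (\<lambda>s t. L1 (- s) t) (- (- \<xi>1)) (- h)" using x1 by simp
    moreover have "cone_state (\<lambda>s t. L1 (- s) t) (- \<xi>1) h T b R" if "cone_state L \<xi> h T b R" for T b R
      unfolding cone_state_def
    proof (intro conjI allI impI)
      fix s t assume "L1 (- s) t \<in> improving b R"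
      then have "0 < t \<and> t + h \<le> T \<and> \<bar>h * (- s) - \<xi>1 * t\<bar> < t + h"
        using state[OF that] unfolding cone_state_def by blast
      then show "0 < t" "t + h \<le> T" "\<bar>h * s - - \<xi>1 * t\<bar> < t + h" by (auto simp: abs_less_iff)
    qed (use that in \<open>auto simp: cone_state_def\<close>)
    ultimately show ?thesis
      using that[OF lattice_chart_flip[OF chart], of "- \<xi>1"] False bound by auto
  qed
qed

text \<open>
The exponents \<open>a\<close> and \<open>j\<close> measure \<open>T / h\<close> and \<open>h\<close>. A step that at least doubles \<open>h\<close> decreases \<open>a\<close> by
one and increases \<open>j\<close> by at most three, since \<open>3 \<le> (3 / 2)\<^sup>3\<close>; a step that shrinks \<open>h\<close> by the factor
\<open>2 / 3\<close> keeps \<open>a\<close> and decreases \<open>j\<close> by one. So \<open>4 * a + j\<close> decreases in every step. The threshold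
\<open>6\<close> is where \<open>h / 2 + 1 \<le> 2 / 3 * h\<close> begins to hold.
\<close>

lemma cone_search:
  assumes "4 * a + j \<le> k" and "lattice_chart L" and "x = L (- \<xi>) (- h)" and "1 \<le> h"
    and "T \<le> h * 2 ^ a" and "h \<le> 6 * (3 / 2) ^ j"
  shows "solvable (k * (6 * Suc i)) (cone_state L \<xi> h T b)
    (\<lambda>b' R. b' \<in> square B \<inter> int_points \<and> improving b' R = {})"
  using assms
proof (induction k arbitrary: a j L \<xi> h T b)
  case (0 a j L \<xi> h T b)
  have "improving b R = {}" if "cone_state L \<xi> h T b R" for R
    by (rule cone_state_short[OF that 0(2)]) (use 0 in simp)
  then show ?case by (intro solvable.answer[of _ _ b]) (auto simp: cone_state_def)
next
  case (Suc k a j L0 \<xi>0 h T b)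
  let ?G = "\<lambda>b' R. b' \<in> square B \<inter> int_points \<and> improving b' R = {}"
  have h: "0 < h" "1 \<le> h" using Suc.prems(4) by auto
  obtain L \<xi> where L: "lattice_chart L" and x: "x = L (- \<xi>) (- h)" and \<xi>: "0 \<le> \<xi>" "\<xi> \<le> h / 2"
    and norm: "\<And>T b R. cone_state L0 \<xi>0 h T b R \<Longrightarrow> cone_state L \<xi> h T b R"
    using cone_state_normalize[OF Suc.prems(2,3) h(1)] by metis
  have imp: "s \<in> \<int>" "t \<in> \<int>" "0 < t" "t + h \<le> T" "\<bar>h * s - \<xi> * t\<bar> < t + h"
    if "cone_state L \<xi> h T b R" "L s t \<in> improving b R" for s t R
    using that lattice_chart_int_points[OF L, of s t] unfolding cone_state_def improving_def by auto
  have "solvable (6 * Suc i + k * (6 * Suc i)) (cone_state L \<xi> h T b) ?G"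
  proof (cases "a = 0")
    case True
    have "improving b R = {}" if "cone_state L \<xi> h T b R" for R
      by (rule cone_state_short[OF that L]) (use Suc.prems(5) True in simp)
    then show ?thesis by (intro solvable.answer[of _ _ b]) (auto simp: cone_state_def)
  next
    case False
    then obtain a' where a: "a = Suc a'" by (cases a) auto
    consider "h \<le> 6" | "6 < h" "\<xi> < 1" | "6 < h" "1 \<le> \<xi>" by linarith
    then show ?thesis
    proof cases
      case 1
      \<comment> \<open>Small \<open>h\<close>: the lines \<open>t = 1, \<dots>, 5\<close> are swept and \<open>t = 6\<close> takes the role of \<open>t = 0\<close>.\<close>
      let ?L2 = "\<lambda>s t. L (s + 0) (t + 6)"
      have L2: "lattice_chart ?L2" by (rule lattice_chart_shift[OF L]) auto
      show ?thesis
      proof (rule sweep_then_line[where n = 5 and T = T])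
        show "lattice_chart (\<lambda>s t. L (s + 0) (t + 1))" by (rule lattice_chart_shift[OF L]) auto
        show "lattice_chart ?L2" by (rule L2)
        show "x = ?L2 (- \<xi>) (- (h + 6))" using x by simp
        fix R s t assume st: "cone_state L \<xi> h T b R" and w: "?L2 s t \<in> improving b R"
          and ne: "\<And>s' j. j < 5 \<Longrightarrow> ?L2 s t \<noteq> L (s' + 0) (real j + 1)"
        have t: "t + 6 \<in> \<int>" "0 < t + 6" "(t + 6) + h \<le> T" using imp[OF st w] by auto
        then obtain n :: int where n: "t + 6 = of_int n" by (metis Ints_cases)
        have "0 \<le> t"
        proof (rule ccontr)
          assume "\<not> 0 \<le> t"
          then have "0 < n" "n < 6" using n t(2) by linarith+
          then have "nat (n - 1) < 5" "t + 6 = real (nat (n - 1)) + 1" using n by auto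
          then show False using ne[of "nat (n - 1)" s] by metis
        qed
        then show "0 \<le> t \<and> t + (h + 6) \<le> T" using t(3) by simp
      next
        fix b' :: "real^2" and p :: real assume p: "p \<in> \<int>"
        show "solvable (k * (6 * Suc i)) (cone_state (\<lambda>s t. ?L2 (s + p) (t + 0)) (\<xi> + p) (h + 6) T b') ?G"
        proof (rule Suc.IH[of a' "j + 2"])
          show "4 * a' + (j + 2) \<le> k" using Suc.prems(1) a by simp
          show "lattice_chart (\<lambda>s t. ?L2 (s + p) (t + 0))"
            by (rule lattice_chart_shift[OF L2 p]) auto
          show "x = ?L2 (- (\<xi> + p) + p) (- (h + 6) + 0)" using x by simp
          have "T \<le> (2 * h) * 2 ^ a'" using Suc.prems(5) a by simp
          also have "\<dots> \<le> (h + 6) * 2 ^ a'" using 1 by (intro mult_right_mono) auto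
          finally show "T \<le> (h + 6) * 2 ^ a'" .
          have "(1::real) \<le> (3 / 2) ^ j" by (rule one_le_power) simp
          moreover have "6 * (3 / 2 :: real) ^ (j + 2) = 27 / 2 * (3 / 2) ^ j"
            by (simp add: power_add power2_eq_square)
          ultimately show "h + 6 \<le> 6 * (3 / 2) ^ (j + 2)" using 1 by linarith
        qed (use h in auto)
      qed (use h in \<open>auto simp: cone_state_def\<close>)
    next
      case 2
      \<comment> \<open>The cone is nearly upright: its lattice points with \<open>0 < t \<le> h\<close> lie on the four lines
        \<open>s = - 1, \<dots>, 2\<close>, and \<open>m\<close> is the level of the first horizontal line above that range.\<close>
      define m where "m = \<lfloor>h\<rfloor> + 1"
      have m: "h < of_int m" "of_int m \<le> h + 1" unfolding m_def by linarith+
      let ?L2 = "\<lambda>s t. L (s + 0) (t + of_int m)"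
      have L2: "lattice_chart ?L2" by (rule lattice_chart_shift[OF L]) auto
      show ?thesis
      proof (rule sweep_then_line[where n = 4 and T = T])
        show "lattice_chart (\<lambda>s t. L (t + - 1) (s + 0))"
          by (rule lattice_chart_swap, rule lattice_chart_shift[OF L]) auto
        show "lattice_chart ?L2" by (rule L2)
        show "x = ?L2 (- \<xi>) (- (h + of_int m))" using x by simp
        fix R s t assume st: "cone_state L \<xi> h T b R" and w: "?L2 s t \<in> improving b R"
          and ne: "\<And>s' j. j < 4 \<Longrightarrow> ?L2 s t \<noteq> L (real j + - 1) (s' + 0)"
        define t' where "t' = t + of_int m"
        have t: "t' \<in> \<int>" "0 < t'" "t' + h \<le> T" and s: "s \<in> \<int>" "\<bar>h * s - \<xi> * t'\<bar> < t' + h"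
          using imp[OF st w] unfolding t'_def by auto
        have "0 \<le> t"
        proof (rule ccontr)
          assume neg: "\<not> 0 \<le> t"
          obtain n :: int where n: "t' = of_int n" using t(1) by (metis Ints_cases)
          have "n < m" using neg n unfolding t'_def by linarith
          then have "n \<le> \<lfloor>h\<rfloor>" unfolding m_def by simp
          then have t'h: "t' \<le> h" unfolding n by linarith
          have xt: "0 \<le> \<xi> * t'" "\<xi> * t' \<le> h"
            using \<xi> t t'h 2 mult_mono[of \<xi> 1 t' h] by auto
          have "h * s < h * 3" "h * (- 2) < h * s" using s(2) xt t'h by linarith+
          then have "s < 3" "- 2 < s" using h mult_less_cancel_left_pos by blast+
          moreover obtain l :: int where l: "s = of_int l" using s(1) by (metis Ints_cases)
          ultimately have "nat (l + 1) < 4" "s = real (nat (l + 1)) + - 1" by auto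
          then show False using ne[of "nat (l + 1)" t'] unfolding t'_def by simp
        qed
        then show "0 \<le> t \<and> t + (h + of_int m) \<le> T" using t(3) unfolding t'_def by simp
      next
        fix b' :: "real^2" and p :: real assume p: "p \<in> \<int>"
        show "solvable (k * (6 * Suc i))
          (cone_state (\<lambda>s t. ?L2 (s + p) (t + 0)) (\<xi> + p) (h + of_int m) T b') ?G"
        proof (rule Suc.IH[of a' "j + 3"])
          show "4 * a' + (j + 3) \<le> k" using Suc.prems(1) a by simp
          show "lattice_chart (\<lambda>s t. ?L2 (s + p) (t + 0))"
            by (rule lattice_chart_shift[OF L2 p]) auto
          show "x = ?L2 (- (\<xi> + p) + p) (- (h + of_int m) + 0)" using x by simp
          have "T \<le> (2 * h) * 2 ^ a'" using Suc.prems(5) a by simp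
          also have "\<dots> \<le> (h + of_int m) * 2 ^ a'" using m by (intro mult_right_mono) auto
          finally show "T \<le> (h + of_int m) * 2 ^ a'" .
          have "h + of_int m \<le> 3 * h" using m h by linarith
          also have "\<dots> \<le> (27 / 8) * (6 * (3 / 2) ^ j)" using Suc.prems(6) h by linarith
          also have "\<dots> = 6 * (3 / 2) ^ (j + 3)" by (simp add: power_add power3_eq_cube)
          finally show "h + of_int m \<le> 6 * (3 / 2) ^ (j + 3)" .
        qed (use h m in auto)
      qed (use h m in \<open>auto simp: cone_state_def\<close>)
    next
      case 3
      \<comment> \<open>The cone leans to the right and lies in \<open>s > - 1\<close>. The line \<open>s = 0\<close> is swept, and \<open>s = 1\<close>
        takes the role of \<open>t = 0\<close> after the coordinates have been exchanged.\<close>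
      obtain j' where j: "j = Suc j'" using 3 Suc.prems(6) by (cases j) auto
      let ?L2 = "\<lambda>s t. L (t + 1) (s + 0)"
      have L2: "lattice_chart ?L2"
        by (rule lattice_chart_swap, rule lattice_chart_shift[OF L]) auto
      \<comment> \<open>At height \<open>t\<close> the cone extends to the distance \<open>(t + h) * (\<xi> + 1) / h\<close> from \<open>x\<close> in the
        direction of \<open>s\<close>, so the ratio of \<open>T\<close> and \<open>h\<close> is the same before and after the step.\<close>
      let ?T = "T / h * (\<xi> + 1)"
      show ?thesis
      proof (rule sweep_then_line[where n = 1 and T = ?T])
        show "lattice_chart (\<lambda>s t. L t s)" by (rule lattice_chart_swap[OF L])
        show "lattice_chart ?L2" by (rule L2)
        show "x = ?L2 (- h) (- (\<xi> + 1))" using x by simp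
        fix R s t assume st: "cone_state L \<xi> h T b R" and w: "?L2 s t \<in> improving b R"
          and ne: "\<And>s' j. j < 1 \<Longrightarrow> ?L2 s t \<noteq> L (real j) s'"
        have s: "0 < s" "s + h \<le> T" and t: "t + 1 \<in> \<int>" "\<bar>h * (t + 1) - \<xi> * s\<bar> < s + h"
          using imp[OF st w] by auto
        have "s \<le> \<xi> * s" using s(1) 3 by simp
        then have "h * (- 1) < h * (t + 1)" using t(2) by (auto simp: abs_less_iff)
        then have "- 1 < t + 1" using h mult_less_cancel_left_pos by blast
        moreover have "t + 1 \<noteq> 0" using ne[of 0 s] by auto
        moreover obtain l :: int where l: "t + 1 = of_int l" using t(1) by (metis Ints_cases)
        ultimately have "-1 < l" "l \<noteq> 0" by auto
        then have "1 \<le> l" by linarith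
        then have t0: "0 \<le> t" using l by linarith
        have "h * (t + (\<xi> + 1)) \<le> (s + h) * (\<xi> + 1)"
          using t(2) by (auto simp: abs_less_iff algebra_simps)
        also have "\<dots> \<le> T * (\<xi> + 1)" using s(2) \<xi> by (intro mult_right_mono) auto
        finally have "t + (\<xi> + 1) \<le> ?T" using h by (simp add: field_simps)
        then show "0 \<le> t \<and> t + (\<xi> + 1) \<le> ?T" using t0 by simp
      next
        fix b' :: "real^2" and p :: real assume p: "p \<in> \<int>"
        show "solvable (k * (6 * Suc i))
          (cone_state (\<lambda>s t. ?L2 (s + p) (t + 0)) (h + p) (\<xi> + 1) ?T b') ?G"
        proof (rule Suc.IH[of a j'])
          show "4 * a + j' \<le> k" using Suc.prems(1) j by simp
          show "lattice_chart (\<lambda>s t. ?L2 (s + p) (t + 0))"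
            using lattice_chart_shift[OF L2 p Ints_0] by simp
          show "x = ?L2 (- (h + p) + p) (- (\<xi> + 1) + 0)" using x by simp
          have "T / h \<le> 2 ^ a" using Suc.prems(5) h by (simp add: field_simps)
          then have "?T \<le> 2 ^ a * (\<xi> + 1)" using \<xi> by (intro mult_right_mono) auto
          then show "?T \<le> (\<xi> + 1) * 2 ^ a" by (simp add: mult.commute)
          have "\<xi> + 1 \<le> 2 / 3 * h" using \<xi> 3 by linarith
          also have "\<dots> \<le> 2 / 3 * (6 * (3 / 2) ^ j)" using Suc.prems(6) by linarith
          also have "\<dots> = 6 * (3 / 2) ^ j'" unfolding j by simp
          finally show "\<xi> + 1 \<le> 6 * (3 / 2) ^ j'" .
        qed (use \<xi> in auto)
      qed (use \<xi> in \<open>auto simp: cone_state_def\<close>)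
    qed
  qed
  then have "solvable (6 * Suc i + k * (6 * Suc i)) (cone_state L0 \<xi>0 h T b) ?G"
    by (rule solvable_mono) (auto intro: norm)
  then show ?case by simp
qed

end

section \<open>Searching the square\<close>

text \<open>
For \<open>\<sigma> = 1\<close> this concerns the part of the square above \<open>x\<close>, for \<open>\<sigma> = - 1\<close> the part below. The first
horizontal lattice line can be arbitrarily close to \<open>x\<close>, which would make \<open>T / h\<close> unbounded. So this
line is swept, and the cone search starts from the second one, at a distance between \<open>1\<close> and \<open>2\<close>.
\<close>

lemma half_square_search:
  assumes \<sigma>: "\<sigma> \<in> {1, -1 :: real}" and x: "x \<in> square B" and i: "2 * int B < 2 ^ i"
  shows "solvable ((4 * i + 1) * (6 * Suc i)) (instance_at B x)
    (\<lambda>b R. b \<in> square B \<inter> int_points \<and>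
       (\<forall>w \<in> square B \<inter> int_points. 0 \<le> \<sigma> * (w $ 2 - x $ 2) \<longrightarrow> R b w))"
proof -
  define Q where "Q = {y \<in> square B. 0 \<le> \<sigma> * (y $ 2 - x $ 2)}"
  define c where "c = real_of_int \<lceil>\<sigma> * x $ 2\<rceil>"
  define L :: "real \<Rightarrow> real \<Rightarrow> real^2" where "L = (\<lambda>s t. \<chi> j. if j = 1 then s else \<sigma> * (t + c))"
  have \<sigma>2: "\<sigma> * \<sigma> = 1" using \<sigma> by auto
  interpret lattice_region B i x Q
  proof
    show "convex Q" unfolding convex_def
    proof (intro ballI allI impI)
      fix y z :: "real^2" and u v :: real
      assume y: "y \<in> Q" and z: "z \<in> Q" and uv: "0 \<le> u" "0 \<le> v" "u + v = 1"
      have "- real B \<le> (u *\<^sub>R y + v *\<^sub>R z) $ j \<and> (u *\<^sub>R y + v *\<^sub>R z) $ j \<le> real B" for j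
      proof -
        have "- real B \<le> y $ j" "y $ j \<le> real B" "- real B \<le> z $ j" "z $ j \<le> real B"
          using y z unfolding Q_def square_def by auto
        then have "u * (- real B) + v * (- real B) \<le> u * y $ j + v * z $ j"
          "u * y $ j + v * z $ j \<le> u * real B + v * real B"
          using uv by (intro add_mono mult_left_mono; simp)+
        moreover have "u * real B + v * real B = real B" "u * (- real B) + v * (- real B) = - real B"
          using uv(3) by (metis distrib_right mult_1)+
        ultimately show ?thesis by simp
      qed
      moreover have "\<sigma> * ((u *\<^sub>R y + v *\<^sub>R z) $ 2 - x $ 2) =
          u * (\<sigma> * (y $ 2 - x $ 2)) + v * (\<sigma> * (z $ 2 - x $ 2))"
      proof -
        have v: "v = 1 - u" using uv(3) by simp
        show ?thesis unfolding v by (simp add: algebra_simps)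
      qed
      then have "0 \<le> \<sigma> * ((u *\<^sub>R y + v *\<^sub>R z) $ 2 - x $ 2)"
        using y z uv unfolding Q_def by auto
      ultimately show "u *\<^sub>R y + v *\<^sub>R z \<in> Q" unfolding Q_def square_def by simp
    qed
  qed (use x i in \<open>auto simp: Q_def\<close>)
  have L: "lattice_chart L"
    unfolding lattice_chart_def
  proof (intro conjI allI)
    have "\<forall>s t. L s t = (\<chi> j. if j = 1 then 0 else \<sigma> * c) + s *\<^sub>R (\<chi> j. if j = 1 then 1 else 0)
        + t *\<^sub>R (\<chi> j. if j = 1 then 0 else \<sigma>)"
      unfolding L_def by (simp add: vec_eq_iff algebra_simps)
    then show "\<exists>p d e. \<forall>s t. L s t = p + s *\<^sub>R d + t *\<^sub>R e" by blast
    fix y :: "real^2"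
    have "\<sigma> * (\<sigma> * y $ 2) = y $ 2" using \<sigma>2 by (simp add: mult.assoc[symmetric])
    then have "y = L (y $ 1) (\<sigma> * y $ 2 - c)" unfolding L_def by (simp add: vec_eq_iff forall_2)
    then show "\<exists>s t. y = L s t" by blast
  next
    fix s t
    have "\<sigma> * z \<in> \<int> \<longleftrightarrow> z \<in> \<int>" for z using \<sigma> by auto
    then have "\<sigma> * (t + c) \<in> \<int> \<longleftrightarrow> t + c \<in> \<int>" .
    also have "\<dots> \<longleftrightarrow> t \<in> \<int>" unfolding c_def by (metis Ints_add Ints_diff Ints_of_int add_diff_cancel_right')
    finally show "L s t \<in> int_points \<longleftrightarrow> s \<in> \<int> \<and> t \<in> \<int>"
      unfolding int_points_def L_def by (simp add: forall_2)
  qed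
  define h where "h = c - \<sigma> * x $ 2 + 1"
  have h: "1 \<le> h" "h \<le> 2" unfolding h_def c_def by linarith+
  have chart: "lattice_chart (\<lambda>s t. L (s + 0) (t + 1))" by (rule lattice_chart_shift[OF L]) auto
  have x_L: "x = L (- (- x $ 1) + 0) (- h + 1)"
    using \<sigma>2 unfolding L_def h_def by (simp add: vec_eq_iff forall_2 mult.assoc[symmetric])
  have "solvable (6 * Suc i + 4 * i * (6 * Suc i)) (instance_at B x)
    (\<lambda>b R. b \<in> square B \<inter> int_points \<and> improving b R = {})"
  proof (rule sweep_then_line[where n = 1 and T = "2 * real B" and b = 0])
    show "lattice_chart L" by (rule L)
    show "lattice_chart (\<lambda>s t. L (s + 0) (t + 1))" by (rule chart)
    show "x = L (- (- x $ 1) + 0) (- h + 1)" by (rule x_L)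
    show "instance_at B x R \<and> 0 \<in> square B \<inter> int_points" if "instance_at B x R" for R
      using that unfolding square_def int_points_def by simp
    fix R s t assume "instance_at B x R" and w: "L (s + 0) (t + 1) \<in> improving 0 R"
      and ne: "\<And>s' j. j < 1 \<Longrightarrow> L (s + 0) (t + 1) \<noteq> L s' (real j)"
    let ?w = "L s (t + 1)"
    have w: "?w \<in> Q" "?w \<in> int_points" using w unfolding improving_def by auto
    have "\<sigma> * ?w $ 2 = t + 1 + c" unfolding L_def using \<sigma>2 by (simp add: mult.assoc[symmetric])
    then have lev: "\<sigma> * (?w $ 2 - x $ 2) = t + h" unfolding h_def by (simp add: algebra_simps)
    then have "0 \<le> t + h" using w(1) unfolding Q_def by auto
    moreover have "t + 1 \<in> \<int>" using w(2) lattice_chart_int_points[OF L] by blast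
    then obtain l :: int where l: "t + 1 = of_int l" by (metis Ints_cases)
    moreover have "h < 2" unfolding h_def c_def by linarith
    ultimately have "-1 < l" by linarith
    moreover have "l \<noteq> 0" using ne[of 0 s] l by auto
    ultimately have "1 \<le> l" by linarith
    then have "0 \<le> t" using l by linarith
    moreover have "\<sigma> * (?w $ 2 - x $ 2) \<le> 2 * real B"
    proof -
      have "- real B \<le> ?w $ 2" "?w $ 2 \<le> real B" "- real B \<le> x $ 2" "x $ 2 \<le> real B"
        using w(1) x unfolding Q_def square_def by blast+
      then show ?thesis using \<sigma> by auto
    qed
    ultimately show "0 \<le> t \<and> t + h \<le> 2 * real B" using lev by simp
  next
    fix b' :: "real^2" and p :: real assume p: "p \<in> \<int>"
    show "solvable (4 * i * (6 * Suc i))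
      (cone_state (\<lambda>s t. L (s + p + 0) (t + 0 + 1)) (- x $ 1 + p) h (2 * real B) b')
      (\<lambda>b R. b \<in> square B \<inter> int_points \<and> improving b R = {})"
    proof (rule cone_search[of i 0])
      show "lattice_chart (\<lambda>s t. L (s + p + 0) (t + 0 + 1))"
        by (rule lattice_chart_shift[OF chart p]) auto
      show "x = L (- (- x $ 1 + p) + p + 0) (- h + 0 + 1)" using x_L by simp
      have "real_of_int (2 * int B) < real_of_int (2 ^ i)" using i by (simp only: of_int_less_iff)
      then have "2 * real B \<le> 2 ^ i" by simp
      also have "\<dots> \<le> h * 2 ^ i" using h by simp
      finally show "2 * real B \<le> h * 2 ^ i" .
    qed (use h in auto)
  qed (use h in auto)
  moreover have "6 * Suc i + 4 * i * (6 * Suc i) = (4 * i + 1) * (6 * Suc i)" by (simp add: algebra_simps)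
  moreover have "R b w"
    if "improving b R = {}" "w \<in> square B \<inter> int_points" "0 \<le> \<sigma> * (w $ 2 - x $ 2)" for R b w
  proof -
    have "w \<in> Q \<inter> int_points" using that unfolding Q_def by blast
    then show ?thesis using that(1) unfolding improving_def by blast
  qed
  ultimately show ?thesis by (elim solvable_mono) auto
qed

lemma square_search:
  assumes x: "x \<in> square B" and i: "2 * int B < 2 ^ i"
  shows "solvable ((8 * i + 2) * (6 * Suc i) + 1) (instance_at B x)
    (\<lambda>b R. b \<in> square B \<inter> int_points \<and> (\<forall>w \<in> square B \<inter> int_points. R b w))"
proof -
  let ?G = "\<lambda>b R. b \<in> square B \<inter> int_points \<and> (\<forall>w \<in> square B \<inter> int_points. R b w)"
  let ?P = "\<lambda>\<sigma> b R. b \<in> square B \<inter> int_points \<and>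
       (\<forall>w \<in> square B \<inter> int_points. 0 \<le> \<sigma> * (w $ 2 - x $ 2) \<longrightarrow> R b w)"
  let ?n = "(4 * i + 1) * (6 * Suc i)"
  let ?I = "\<lambda>b b' R. (instance_at B x R \<and> ?P 1 b R) \<and> ?P (- 1) b' R"
  have half: "solvable ?n (instance_at B x) (?P \<sigma>)" if "\<sigma> \<in> {1, -1}" for \<sigma>
    by (rule half_square_search[OF that x i])
  have merge: "solvable (Suc 0) (?I b b') ?G" for b b'
  proof (rule solvable.compare[where y = b and z = b'])
    have *: "R b w \<or> R b' w" if "?I b b' R" "w \<in> square B \<inter> int_points" for R w
    proof (cases "x $ 2 \<le> w $ 2")
      case True then show ?thesis using that by simp
    next
      case False
      then have "0 \<le> - 1 * (w $ 2 - x $ 2)" by simp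
      then show ?thesis using that by blast
    qed
    have pref: "convex_preference R" if "?I b b' R" for R using that unfolding instance_at_def by blast
    show "solvable 0 (\<lambda>R. ?I b b' R \<and> R b b') ?G"
    proof (rule solvable.answer[where r = b])
      fix R assume R: "?I b b' R \<and> R b b'"
      then have "R b w" if "w \<in> square B \<inter> int_points" for w
        using *[of R w] pref[of R] convex_preference_trans[of R b b' w] that by blast
      then show "?G b R" using R by blast
    qed
    show "solvable 0 (\<lambda>R. ?I b b' R \<and> \<not> R b b') ?G"
    proof (rule solvable.answer[where r = b'])
      fix R assume R: "?I b b' R \<and> \<not> R b b'"
      then have "R b' b" using pref[of R] convex_preference_total by blast
      then have "R b' w" if "w \<in> square B \<inter> int_points" for w
        using R *[of R w] pref[of R] convex_preference_trans[of R b' b w] that by blast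
      then show "?G b' R" using R by blast
    qed
  qed
  have "solvable (?n + Suc 0) (\<lambda>R. instance_at B x R \<and> ?P 1 b R) ?G" for b
  proof (rule solvable_bind)
    show "solvable ?n (\<lambda>R. instance_at B x R \<and> ?P 1 b R) (?P (- 1))"
      by (rule solvable_mono[OF half[of "- 1"]]) auto
    show "solvable (Suc 0) (?I b b') ?G" for b' by (rule merge)
  qed
  then have "solvable (?n + (?n + Suc 0)) (instance_at B x) ?G"
    by (intro solvable_bind[OF half]) auto
  moreover have "?n + (?n + Suc 0) = (8 * i + 2) * (6 * Suc i) + 1" by (simp add: algebra_simps)
  ultimately show ?thesis by (simp only:)
qed

section \<open>Comparing points by evaluations\<close>

primrec penalty :: "nat \<Rightarrow> (nat \<Rightarrow> real^2 \<Rightarrow> real) \<Rightarrow> real^2 \<Rightarrow> real" where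
  "penalty 0 g y = 0"
| "penalty (Suc m) g y = max (penalty m g y) (g (Suc m) y)"

definition preference ::
  "nat \<Rightarrow> (real^2 \<Rightarrow> real) \<Rightarrow> (nat \<Rightarrow> real^2 \<Rightarrow> real) \<Rightarrow> real^2 \<Rightarrow> real^2 \<Rightarrow> bool" where
  "preference m f g y z \<longleftrightarrow> penalty m g y < penalty m g z \<or>
     penalty m g y = penalty m g z \<and> f y \<le> f z"

lemma penalty_nonneg: "0 \<le> penalty m g y"
  by (induction m) auto

lemma penalty_le_0_iff: "penalty m g y \<le> 0 \<longleftrightarrow> satisfies m g y"
  by (induction m) (auto simp: satisfies_def le_Suc_eq)

lemma convex_on_penalty:
  assumes "\<forall>i\<in>{1..m}. convex_on UNIV (g i)"
  shows "convex_on UNIV (penalty m g)"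
  using assms
proof (induction m)
  case 0
  then show ?case by (simp add: convex_on_def)
next
  case (Suc m)
  then have c: "convex_on UNIV (penalty m g)" "convex_on UNIV (g (Suc m))" by auto
  show ?case
  proof (rule convex_onI)
    fix t :: real and y z :: "real^2" assume t: "0 < t" "t < 1"
    let ?v = "(1 - t) *\<^sub>R y + t *\<^sub>R z"
    have "penalty m g ?v \<le> (1 - t) * penalty m g y + t * penalty m g z"
      "g (Suc m) ?v \<le> (1 - t) * g (Suc m) y + t * g (Suc m) z"
      using convex_onD[OF c(1), of t y z] convex_onD[OF c(2), of t y z] t by auto
    moreover have "(1 - t) * q \<le> (1 - t) * max q q'" "(1 - t) * q' \<le> (1 - t) * max q q'"
      "t * q \<le> t * max q q'" "t * q' \<le> t * max q q'" for q q'
      using t by (intro mult_left_mono; simp)+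
    ultimately show "penalty (Suc m) g ?v \<le> (1 - t) * penalty (Suc m) g y + t * penalty (Suc m) g z"
      unfolding penalty.simps by (smt (verit) max_def)
  qed simp
qed

text \<open>
A convex combination of three points of the graph lies in the epigraph.
\<close>

lemma convex_on_combination_3:
  assumes f: "convex_on UNIV f" and abc: "0 \<le> a" "0 \<le> b" "0 < c" "a + b + c = 1"
  shows "f (a *\<^sub>R u + b *\<^sub>R v + c *\<^sub>R w) \<le> a * f u + b * f v + c * f w"
proof -
  have "convex (epigraph UNIV f)" using f by (simp add: convex_epigraph)
  then have "a *\<^sub>R (u, f u) + b *\<^sub>R (v, f v) + c *\<^sub>R (w, f w) \<in> epigraph UNIV f"
    using abc by (intro convex_combination_3) (auto simp: epigraph_def)
  then show ?thesis by (simp add: epigraph_def)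
qed

text \<open>
If \<open>w\<close> were better than \<open>z\<close>, convexity of the penalty would force every point that occurs with positive
weight to have the penalty of \<open>z\<close>. Then \<open>w\<close> is better, and the others are no worse, in the objective
alone, which contradicts convexity of the objective.
\<close>

lemma convex_preference_preference:
  assumes f: "convex_on UNIV f" and g: "\<forall>i\<in>{1..m}. convex_on UNIV (g i)"
  shows "convex_preference (preference m f g)"
  unfolding convex_preference_def
proof (intro conjI allI impI)
  fix u v w z :: "real^2" and a b c :: real
  assume abc: "0 \<le> a" "0 \<le> b" "0 < c" "a + b + c = 1"
    and z: "z = a *\<^sub>R u + b *\<^sub>R v + c *\<^sub>R w"
    and u: "preference m f g u z" and v: "preference m f g v z"
  let ?p = "penalty m g"
  have pz: "?p z \<le> a * ?p u + b * ?p v + c * ?p w" and fz: "f z \<le> a * f u + b * f v + c * f w"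
    unfolding z using convex_on_combination_3[OF _ abc] f convex_on_penalty[OF g] by blast+
  have split: "q = a * q + b * q + c * q" for q
    using abc(4) by (metis distrib_right mult_1)
  have pu: "a * ?p u \<le> a * ?p z" and pv: "b * ?p v \<le> b * ?p z"
    using u v abc unfolding preference_def by (auto intro: mult_left_mono)
  show "preference m f g z w"
  proof (rule ccontr)
    assume n: "\<not> preference m f g z w"
    then have "?p w \<le> ?p z" unfolding preference_def by auto
    then have pw: "c * ?p w \<le> c * ?p z" using abc by (intro mult_left_mono) auto
    have eq: "a * ?p u = a * ?p z" "b * ?p v = b * ?p z" "c * ?p w = c * ?p z"
      using pz pu pv pw split[of "?p z"] by linarith+
    have "a * f u \<le> a * f z" "b * f v \<le> b * f z"
      using u v eq(1,2) abc unfolding preference_def by (auto intro: mult_left_mono)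
    moreover have "f w < f z" using n eq(3) abc unfolding preference_def by auto
    then have "c * f w < c * f z" using abc by simp
    ultimately show False using fz split[of "f z"] by linarith
  qed
qed (auto simp: preference_def)

text \<open>
Written in continuation-passing style, which makes sequencing of query trees plain application.
\<close>

primrec eval_penalty :: "nat \<Rightarrow> real^2 \<Rightarrow> (real \<Rightarrow> 'r eval_alg) \<Rightarrow> 'r eval_alg" where
  "eval_penalty 0 y k = k 0"
| "eval_penalty (Suc m) y k =
     eval_penalty m y (\<lambda>v. Eval_constraint (Suc m) y (\<lambda>w. k (max v w)))"

lemma run_eval_penalty: "run (eval_penalty m y k) f g = run (k (penalty m g y)) f g"
  by (induction m arbitrary: k) auto

lemma num_evals_eval_penalty:
  "num_evals (eval_penalty m y k) f g = m + num_evals (k (penalty m g y)) f g"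
  by (induction m arbitrary: k) auto

lemma queries_within_eval_penalty:
  "n \<le> m \<Longrightarrow> (\<And>v. queries_within m (k v)) \<Longrightarrow> queries_within m (eval_penalty n y k)"
  by (induction n arbitrary: k) auto

definition eval_preference ::
  "nat \<Rightarrow> real^2 \<Rightarrow> real^2 \<Rightarrow> 'r eval_alg \<Rightarrow> 'r eval_alg \<Rightarrow> 'r eval_alg" where
  "eval_preference m y z t t' =
     eval_penalty m y (\<lambda>p. Eval_objective y (\<lambda>v. eval_penalty m z (\<lambda>q. Eval_objective z (\<lambda>w.
       if p < q \<or> p = q \<and> v \<le> w then t else t'))))"

lemma run_eval_preference:
  "run (eval_preference m y z t t') f g = (if preference m f g y z then run t f g else run t' f g)"
  by (simp add: eval_preference_def run_eval_penalty preference_def)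

lemma num_evals_eval_preference:
  "num_evals (eval_preference m y z t t') f g =
     2 * (m + 1) + (if preference m f g y z then num_evals t f g else num_evals t' f g)"
  by (simp add: eval_preference_def num_evals_eval_penalty preference_def)

lemma queries_within_eval_preference:
  "queries_within m t \<Longrightarrow> queries_within m t' \<Longrightarrow> queries_within m (eval_preference m y z t t')"
  unfolding eval_preference_def by (intro queries_within_eval_penalty) (auto intro!: queries_within_eval_penalty)

text \<open>
A derivation of \<open>solvable\<close> is turned into a query tree by replacing each comparison by the evaluation
of both penalties and objective values. The continuation \<open>k\<close> receives the answer.
\<close>

lemma solvable_eval_alg:
  assumes "solvable n I P" and "\<And>r. queries_within m (k r)"
  shows "\<exists>t. queries_within m t \<and> (\<forall>f g. I (preference m f g) \<longrightarrow>
    (\<exists>r. P r (preference m f g) \<and> run t f g = run (k r) f g \<and>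
      num_evals t f g \<le> n * (2 * (m + 1)) + num_evals (k r) f g))"
  using assms
proof (induction rule: solvable.induct)
  case (answer I P r n)
  then show ?case by (intro exI[of _ "k r"] conjI allI impI exI[of _ r]) auto
next
  case (compare n I y z P)
  from compare.IH(1)[OF compare.prems] obtain t where t: "queries_within m t"
    "\<And>f g. I (preference m f g) \<Longrightarrow> preference m f g y z \<Longrightarrow>
      \<exists>r. P r (preference m f g) \<and> run t f g = run (k r) f g \<and>
        num_evals t f g \<le> n * (2 * (m + 1)) + num_evals (k r) f g"
    by blast
  from compare.IH(2)[OF compare.prems] obtain t' where t': "queries_within m t'"
    "\<And>f g. I (preference m f g) \<Longrightarrow> \<not> preference m f g y z \<Longrightarrow>
      \<exists>r. P r (preference m f g) \<and> run t' f g = run (k r) f g \<and>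
        num_evals t' f g \<le> n * (2 * (m + 1)) + num_evals (k r) f g"
    by blast
  show ?case
  proof (intro exI[of _ "eval_preference m y z t t'"] conjI allI impI)
    show "queries_within m (eval_preference m y z t t')"
      using t(1) t'(1) by (rule queries_within_eval_preference)
    fix f g assume I: "I (preference m f g)"
    show "\<exists>r. P r (preference m f g) \<and> run (eval_preference m y z t t') f g = run (k r) f g \<and>
      num_evals (eval_preference m y z t t') f g \<le> Suc n * (2 * (m + 1)) + num_evals (k r) f g"
      using t(2)[OF I] t'(2)[OF I]
      by (cases "preference m f g y z") (auto simp: run_eval_preference num_evals_eval_preference)
  qed
qed

text \<open>
The inequality \<open>f x \<le> int_opt m B f g\<close> compares \<open>x\<close> with the feasible integer points; infeasible ones
are worse than \<open>x\<close> because of their positive penalty.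
\<close>

lemma instance_at_preference:
  assumes "convex_on UNIV f" "\<forall>i\<in>{1..m}. convex_on UNIV (g i)"
    and x: "satisfies m g x" "ereal (f x) \<le> int_opt m B f g"
  shows "instance_at B x (preference m f g)"
  unfolding instance_at_def
proof (intro conjI ballI)
  show "convex_preference (preference m f g)" by (rule convex_preference_preference[OF assms(1,2)])
  fix w assume w: "w \<in> square B \<inter> int_points"
  have px: "penalty m g x = 0" using x(1) penalty_le_0_iff penalty_nonneg by (metis antisym)
  show "preference m f g x w"
  proof (cases "satisfies m g w")
    case True
    then have "int_opt m B f g \<le> ereal (f w)" unfolding int_opt_def using w by (intro INF_lower) auto
    then have "f x \<le> f w" using x(2) by (metis ereal_less_eq(3) order_trans)
    moreover have "penalty m g w = 0" using True penalty_le_0_iff penalty_nonneg by (metis antisym)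
    ultimately show ?thesis using px unfolding preference_def by simp
  next
    case False
    then have "0 < penalty m g w" using penalty_le_0_iff[of m g w] by linarith
    then show ?thesis using px unfolding preference_def by simp
  qed
qed

text \<open>
A best integer point is feasible if any integer point of the square is, since feasible points are
preferred to infeasible ones.
\<close>

lemma correct_outcome_best:
  assumes b: "b \<in> square B \<inter> int_points" and best: "\<forall>w \<in> square B \<inter> int_points. preference m f g b w"
  shows "correct_outcome m B f g (if penalty m g b \<le> 0 then Found b else No_such_point)"
proof (cases "penalty m g b \<le> 0")
  case True
  have "f b \<le> f w" if "w \<in> square B \<inter> int_points" "satisfies m g w" for w
  proof -
    have "penalty m g w = 0" using that penalty_le_0_iff penalty_nonneg by (metis antisym)
    moreover have "penalty m g b = 0" using True penalty_nonneg by (metis antisym)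
    moreover have "preference m f g b w" using best that(1) by blast
    ultimately show ?thesis unfolding preference_def by simp
  qed
  then have "int_opt m B f g = ereal (f b)"
    unfolding int_opt_def using b True penalty_le_0_iff
    by (intro antisym INF_greatest INF_lower) auto
  then show ?thesis
    using b True penalty_le_0_iff unfolding correct_outcome_def is_int_minimizer_def by simp
next
  case False
  have "\<not> satisfies m g w" if "w \<in> square B \<inter> int_points" for w
  proof -
    have "preference m f g b w" using best that by blast
    then have "penalty m g b \<le> penalty m g w" unfolding preference_def by auto
    then show ?thesis using False penalty_le_0_iff[of m g w] by linarith
  qed
  then show ?thesis using False unfolding correct_outcome_def is_int_minimizer_def by auto
qed

section \<open>The number of evaluations\<close>

lemma binary_digits_bound:
  assumes "1 \<le> B"
  shows "\<exists>i. 2 * int B < 2 ^ i \<and> real i \<le> 2 + 2 * ln (real B)"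
proof -
  obtain n where n: "2 ^ n \<le> 2 * B" "2 * B < 2 ^ (n + 1)"
    using ex_power_ivl1[of 2 "2 * B"] assms by auto
  have "real n * ln 2 = ln (2 ^ n)" by (simp add: ln_realpow)
  also have "\<dots> \<le> ln (2 * real B)"
  proof -
    have "real (2 ^ n) \<le> real (2 * B)" using n(1) by (rule of_nat_mono)
    then show ?thesis using assms by (subst ln_le_cancel_iff) auto
  qed
  also have "\<dots> = ln 2 + ln (real B)" using assms by (simp add: ln_mult)
  finally have *: "(real n - 1) * ln 2 \<le> ln (real B)" by (simp add: algebra_simps)
  have "(1::real) / 2 \<le> ln 2" using ln2_ge_two_thirds by simp
  then have "(real n - 1) * (1 / 2) \<le> ln (real B)"
  proof (cases "1 \<le> n")
    case True
    then have "(real n - 1) * (1 / 2) \<le> (real n - 1) * ln 2"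
      using \<open>1 / 2 \<le> ln 2\<close> by (intro mult_left_mono) auto
    then show ?thesis using * by linarith
  next
    case False
    moreover have "0 \<le> ln (real B)" using assms by simp
    ultimately show ?thesis by (simp add: not_le)
  qed
  then have "real (n + 1) \<le> 2 + 2 * ln (real B)" by simp
  moreover have "2 * int B < 2 ^ (n + 1)" using n(2) by (metis of_nat_less_iff of_nat_mult of_nat_numeral of_nat_power)
  ultimately show ?thesis by blast
qed

text \<open>
With \<open>N\<close> comparisons and the final evaluation of one penalty, there are at most
\<open>(m + 1) * (2 * N + 1)\<close> evaluations. The polynomial results from inserting \<open>i \<le> 2 + 2 * ln B\<close>.
\<close>

lemma eval_alg_for_square:
  assumes "1 \<le> B" and x: "x \<in> square B"
  shows "\<exists>t. queries_within m t \<and>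
    (\<forall>f g. instance_at B x (preference m f g) \<longrightarrow>
       real (num_evals t f g) \<le>
         (real m + 1) * poly (smult 12 ([:18, 16:] * [:3, 2:]) + [:3:]) (ln (real B)) \<and>
       correct_outcome m B f g (run t f g))"
proof -
  obtain i where i: "2 * int B < 2 ^ i" "real i \<le> 2 + 2 * ln (real B)"
    using binary_digits_bound[OF assms(1)] by blast
  define N where "N = (8 * i + 2) * (6 * Suc i) + 1"
  define k where "k = (\<lambda>b. eval_penalty m b
    (\<lambda>v. Return (if v \<le> 0 then Found b else No_such_point)))"
  have "queries_within m (k b)" for b
    unfolding k_def by (rule queries_within_eval_penalty) auto
  then obtain t where t: "queries_within m t" "\<And>f g. instance_at B x (preference m f g) \<Longrightarrow>
      \<exists>b. (b \<in> square B \<inter> int_points \<and> (\<forall>w \<in> square B \<inter> int_points. preference m f g b w)) \<and>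
        run t f g = run (k b) f g \<and> num_evals t f g \<le> N * (2 * (m + 1)) + num_evals (k b) f g"
    using solvable_eval_alg[OF square_search[OF x i(1)], of m k] unfolding N_def by blast
  have "real (num_evals t f g) \<le>
         (real m + 1) * poly (smult 12 ([:18, 16:] * [:3, 2:]) + [:3:]) (ln (real B)) \<and>
       correct_outcome m B f g (run t f g)" if inst: "instance_at B x (preference m f g)" for f g
  proof -
    obtain b where b: "b \<in> square B \<inter> int_points"
        "\<forall>w \<in> square B \<inter> int_points. preference m f g b w"
      and run: "run t f g = run (k b) f g"
      and num: "num_evals t f g \<le> N * (2 * (m + 1)) + num_evals (k b) f g"
      using t(2)[OF inst] by blast
    have "num_evals t f g \<le> (m + 1) * (2 * N + 1)"
      using num unfolding k_def by (simp add: num_evals_eval_penalty algebra_simps)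
    then have "real (num_evals t f g) \<le> (real m + 1) * (2 * real N + 1)"
      using of_nat_mono[of "num_evals t f g" "(m + 1) * (2 * N + 1)", where 'a = real] by (simp add: algebra_simps)
    also have "\<dots> \<le> (real m + 1) * poly (smult 12 ([:18, 16:] * [:3, 2:]) + [:3:]) (ln (real B))"
    proof (rule mult_left_mono)
      have "(8 * real i + 2) * (real i + 1) \<le> (18 + 16 * ln (real B)) * (3 + 2 * ln (real B))"
        using i(2) by (intro mult_mono) auto
      then show "2 * real N + 1 \<le> poly (smult 12 ([:18, 16:] * [:3, 2:]) + [:3:]) (ln (real B))"
        unfolding N_def by (simp add: algebra_simps)
    qed simp
    finally show ?thesis
      using correct_outcome_best[OF b] unfolding run k_def by (simp add: run_eval_penalty)
  qed
  then show ?thesis using t(1) by blast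
qed

theorem corollary1:
  "\<exists>(alg :: nat \<Rightarrow> nat \<Rightarrow> real^2 \<Rightarrow> outcome eval_alg) (p :: real poly).
     (\<forall>m B x. queries_within m (alg m B x)) \<and>
     (\<forall>(m :: nat) (B :: nat) (x :: real^2) (f :: real^2 \<Rightarrow> real) (g :: nat \<Rightarrow> real^2 \<Rightarrow> real).
        1 \<le> B \<longrightarrow>
        convex_on UNIV f \<longrightarrow>
        (\<forall>i\<in>{1..m}. convex_on UNIV (g i)) \<longrightarrow>
        x \<in> square B \<longrightarrow>
        satisfies m g x \<longrightarrow>
        ereal (f x) \<le> int_opt m B f g \<longrightarrow>
        real (num_evals (alg m B x) f g) \<le> (real m + 1) * poly p (ln (real B)) \<and>
        correct_outcome m B f g (run (alg m B x) f g))"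
proof -
  let ?p = "smult 12 ([:18, 16:] * [:3, 2:]) + [:3:] :: real poly"
  have "\<forall>m B x. \<exists>t. queries_within m t \<and> (1 \<le> B \<longrightarrow> x \<in> square B \<longrightarrow>
    (\<forall>f g. instance_at B x (preference m f g) \<longrightarrow>
       real (num_evals t f g) \<le> (real m + 1) * poly ?p (ln (real B)) \<and>
       correct_outcome m B f g (run t f g)))"
  proof (intro allI)
    fix m B :: nat and x :: "real^2"
    show "\<exists>t. queries_within m t \<and> (1 \<le> B \<longrightarrow> x \<in> square B \<longrightarrow>
      (\<forall>f g. instance_at B x (preference m f g) \<longrightarrow>
         real (num_evals t f g) \<le> (real m + 1) * poly ?p (ln (real B)) \<and>
         correct_outcome m B f g (run t f g)))"
    proof (cases "1 \<le> B \<and> x \<in> square B")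
      case True
      then show ?thesis using eval_alg_for_square[of B x m] by blast
    next
      case False
      then show ?thesis by (intro exI[of _ "Return No_such_point"]) auto
    qed
  qed
  then obtain alg where alg: "\<And>m B x. queries_within m (alg m B x)"
    "\<And>m B x f g. 1 \<le> B \<Longrightarrow> x \<in> square B \<Longrightarrow> instance_at B x (preference m f g) \<Longrightarrow>
       real (num_evals (alg m B x) f g) \<le> (real m + 1) * poly ?p (ln (real B)) \<and>
       correct_outcome m B f g (run (alg m B x) f g)"
    by metis
  show ?thesis
  proof (rule exI[of _ alg], rule exI[of _ ?p], intro conjI allI impI)
    show "queries_within m (alg m B x)" for m B x by (rule alg(1))
  next
    fix m B :: nat and x :: "real^2" and f :: "real^2 \<Rightarrow> real" and g :: "nat \<Rightarrow> real^2 \<Rightarrow> real"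
    assume "1 \<le> B" "convex_on UNIV f" "\<forall>i\<in>{1..m}. convex_on UNIV (g i)" "x \<in> square B"
      "satisfies m g x" "ereal (f x) \<le> int_opt m B f g"
    note result = alg(2)[OF \<open>1 \<le> B\<close> \<open>x \<in> square B\<close> instance_at_preference[OF this(2,3,5,6)]]
    show "real (num_evals (alg m B x) f g) \<le> (real m + 1) * poly ?p (ln (real B))"
      using result by (rule conjunct1)
    show "correct_outcome m B f g (run (alg m B x) f g)"
      using result by (rule conjunct2)
  qed
qed

end
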